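(* Let $G$ be a non-elementary word-hyperbolic group. For each $g \in G$ whose conjugacy class $C(g)$ is finite, let $\chi_g : C^*_{\mathrm{red}}(G) \to \mathbb{C}$ be the bounded linear functional determined on group elements $h \in G$ by $$\chi_g(h) = \begin{cases} 1 & \text{if } h \in C(g), \\ 0 & \text{otherwise.}\end{cases}$$ Then the traces $\theta : C^*_{\mathrm{red}}(G) \to \mathbb{C}$ are exactly the linear combinations of the functionals $\chi_g$, where $g$ ranges over the elements of $G$ with finite conjugacy class.
   Context: Let $G$ be a finitely generated discrete group with a finite generating set, and consider the Cayley graph of $G$ as a geodesic metric space in which each edge is identified with the unit interval. For $\delta>0$, $G$ is $\delta$-hyperbolic if for all $x,y,z \in G$ one has $[x,y] \subset B_\delta([y,z]\cup[z,x])$, where $[x,y]$ denotes a geodesic between $x$ and $y$ and $B_\delta(X)$ is the set of points at distance less than $\delta$ from some point of $X$; $G$ is (word-)hyperbolic if it is $\delta$-hyperbolic for some $\delta>0$. $G$ is called elementary if it contains $\mathbb{Z}$ as a finite index subgroup, and non-elementary otherwise. The group $G$ acts on $\ell^2(G)$ by bounded operators (the regular representation), giving a map $\mathbb{C}[G] \to B(\ell^2(G))$; the reduced group $C^*$-algebra $C^*_{\mathrm{red}}(G)$ is the operator norm closure of $\mathbb{C}[G]$ in $B(\ell^2(G))$. Elements of $G$ are regarded as elements of $C^*_{\mathrm{red}}(G)$. A trace on $C^*_{\mathrm{red}}(G)$ is a bounded linear map $\tau : C^*_{\mathrm{red}}(G) \to \mathbb{C}$ (not necessarily positive) with $\tau(xy)=\tau(yx)$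 for all $x,y$. $C(g)$ denotes the conjugacy class of $g$ in $G$. *)

theory Defs
  imports "HOL-Analysis.Analysis" "HOL-Algebra.Generated_Groups" "HOL-Algebra.Elementary_Groups"
begin

section \<open>The Cayley graph and hyperbolic groups\<close>

definition word_length :: "('a, 'b) monoid_scheme \<Rightarrow> 'a set \<Rightarrow> 'a \<Rightarrow> nat" where
  "word_length G S g = (LEAST n. \<exists>ws. length ws = n \<and> set ws \<subseteq> S \<union> m_inv G ` S \<and>
                                      foldr (\<otimes>\<^bsub>G\<^esub>) ws \<one>\<^bsub>G\<^esub> = g)"

definition word_dist :: "('a, 'b) monoid_scheme \<Rightarrow> 'a set \<Rightarrow> 'a \<Rightarrow> 'a \<Rightarrow> nat" where
  "word_dist G S a b = word_length G S (inv\<^bsub>G\<^esub> a \<otimes>\<^bsub>G\<^esub> b)"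

text \<open>The Cayley graph as a metric space is its geometric realisation.  A point is given by its
  barycentric coordinates \<open>p :: 'a \<Rightarrow> real\<close>, whose support is a vertex \<open>{a}\<close> or the set of end
  points \<open>{a, b}\<close> of an edge; on an edge, \<open>p b = 1 - p a\<close> is the parameter in the unit interval.
  (Loops, and multiple edges between the same two vertices, are not represented.)\<close>

definition cayley_cells :: "('a, 'b) monoid_scheme \<Rightarrow> 'a set \<Rightarrow> 'a set set" where
  "cayley_cells G S = {{a} | a. a \<in> carrier G} \<union> {{a, a \<otimes>\<^bsub>G\<^esub> s} | a s. a \<in> carrier G \<and> s \<in> S}"

definition support :: "('a \<Rightarrow> real) \<Rightarrow> 'a set" where
  "support p = {a. p a \<noteq> 0}"

definition cayley_graph :: "('a, 'b) monoid_scheme \<Rightarrow> 'a set \<Rightarrow> ('a \<Rightarrow> real) set" where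
  "cayley_graph G S = {p. (\<forall>a. 0 \<le> p a) \<and> support p \<in> cayley_cells G S \<and> (\<Sum>a\<in>support p. p a) = 1}"

definition vertex :: "'a \<Rightarrow> 'a \<Rightarrow> real" where
  "vertex a = indicator {a}"

text \<open>The path metric in which every edge has length 1.  Two points of a common edge are at the
  distance of their parameters (both coordinates change by this amount, whence the factor 1/2).
  Otherwise a shortest path leaves the edge of \<open>p\<close> through an end point \<open>a\<close>, which is at
  distance \<open>1 - p a\<close> from \<open>p\<close>, and enters the edge of \<open>q\<close> through an end point \<open>b\<close>.\<close>

definition cayley_dist ::
    "('a, 'b) monoid_scheme \<Rightarrow> 'a set \<Rightarrow> ('a \<Rightarrow> real) \<Rightarrow> ('a \<Rightarrow> real) \<Rightarrow> real" where
  "cayley_dist G S p q =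
     (if \<exists>e\<in>cayley_cells G S. support p \<union> support q \<subseteq> e
      then (\<Sum>a\<in>support p \<union> support q. \<bar>p a - q a\<bar>) / 2
      else Min {(1 - p a) + real (word_dist G S a b) + (1 - q b) | a b. a \<in> support p \<and> b \<in> support q})"

definition geodesic_segment ::
    "('a, 'b) monoid_scheme \<Rightarrow> 'a set \<Rightarrow> ('a \<Rightarrow> real) \<Rightarrow> ('a \<Rightarrow> real) \<Rightarrow> ('a \<Rightarrow> real) set \<Rightarrow> bool" where
  "geodesic_segment G S x y P \<longleftrightarrow>
     (\<exists>\<gamma> L. 0 \<le> L \<and> \<gamma> ` {0..L} \<subseteq> cayley_graph G S \<and> \<gamma> 0 = x \<and> \<gamma> L = y \<and>
            (\<forall>s\<in>{0..L}. \<forall>t\<in>{0..L}. cayley_dist G S (\<gamma> s) (\<gamma> t) = \<bar>s - t\<bar>) \<and> P = \<gamma> ` {0..L})"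

definition cayley_nbhd ::
    "('a, 'b) monoid_scheme \<Rightarrow> 'a set \<Rightarrow> real \<Rightarrow> ('a \<Rightarrow> real) set \<Rightarrow> ('a \<Rightarrow> real) set" where
  "cayley_nbhd G S \<delta> X = {p \<in> cayley_graph G S. \<exists>q\<in>X. cayley_dist G S p q < \<delta>}"

definition delta_hyperbolic :: "('a, 'b) monoid_scheme \<Rightarrow> 'a set \<Rightarrow> real \<Rightarrow> bool" where
  "delta_hyperbolic G S \<delta> \<longleftrightarrow>
     (\<forall>x\<in>carrier G. \<forall>y\<in>carrier G. \<forall>z\<in>carrier G. \<forall>P Q R.
        geodesic_segment G S (vertex x) (vertex y) P \<longrightarrow>
        geodesic_segment G S (vertex y) (vertex z) Q \<longrightarrow>
        geodesic_segment G S (vertex z) (vertex x) R \<longrightarrow>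
        P \<subseteq> cayley_nbhd G S \<delta> (Q \<union> R))"

definition word_hyperbolic :: "('a, 'b) monoid_scheme \<Rightarrow> bool" where
  "word_hyperbolic G \<longleftrightarrow>
     (\<exists>S. finite S \<and> S \<subseteq> carrier G \<and> generate G S = carrier G \<and>
          (\<exists>\<delta>>0. delta_hyperbolic G S \<delta>))"

definition elementary :: "('a, 'b) monoid_scheme \<Rightarrow> bool" where
  "elementary G \<longleftrightarrow>
     (\<exists>H. subgroup H G \<and> (G\<lparr>carrier := H\<rparr>) \<cong> integer_group \<and> finite (rcosets\<^bsub>G\<^esub> H))"

definition conj_class :: "('a, 'b) monoid_scheme \<Rightarrow> 'a \<Rightarrow> 'a set" where
  "conj_class G g = {x \<otimes>\<^bsub>G\<^esub> g \<otimes>\<^bsub>G\<^esub> inv\<^bsub>G\<^esub> x | x. x \<in> carrier G}"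

section \<open>Square-summable functions\<close>

lemma square_summable_add:
  fixes f g :: "'a \<Rightarrow> complex"
  assumes "(\<lambda>x. (cmod (f x))\<^sup>2) summable_on UNIV" and "(\<lambda>x. (cmod (g x))\<^sup>2) summable_on UNIV"
  shows "(\<lambda>x. (cmod (f x + g x))\<^sup>2) summable_on UNIV"
proof (rule summable_on_comparison_test)
  show "(\<lambda>x. 2 * (cmod (f x))\<^sup>2 + 2 * (cmod (g x))\<^sup>2) summable_on UNIV"
    by (intro summable_on_add summable_on_cmult_right assms)
  fix x
  have "(cmod (f x + g x))\<^sup>2 \<le> (cmod (f x) + cmod (g x))\<^sup>2"
    by (intro power_mono norm_triangle_ineq) auto
  also have "\<dots> \<le> 2 * (cmod (f x))\<^sup>2 + 2 * (cmod (g x))\<^sup>2"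
    using sum_squares_bound[of "cmod (f x)" "cmod (g x)"] by (simp add: power2_sum)
  finally show "(cmod (f x + g x))\<^sup>2 \<le> 2 * (cmod (f x))\<^sup>2 + 2 * (cmod (g x))\<^sup>2" .
qed auto

lemma square_summable_mult:
  fixes f :: "'a \<Rightarrow> complex"
  assumes "(\<lambda>x. (cmod (f x))\<^sup>2) summable_on UNIV"
  shows "(\<lambda>x. (cmod (c * f x))\<^sup>2) summable_on UNIV"
  using summable_on_cmult_right[OF assms, of "(cmod c)\<^sup>2"]
  by (simp add: norm_mult power_mult_distrib)

typedef 'a ell2 = "{f :: 'a \<Rightarrow> complex. (\<lambda>x. (cmod (f x))\<^sup>2) summable_on UNIV}"
  morphisms coord Abs_ell2
  by (rule exI[of _ "\<lambda>_. 0"]) auto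

setup_lifting type_definition_ell2

lemma coord_square_summable: "(\<lambda>x. (cmod (coord v x))\<^sup>2) summable_on UNIV"
  using coord[of v] by simp

lemma coord_inner_summable: "(\<lambda>x. inner (coord v x) (coord w x)) summable_on UNIV"
proof (rule abs_summable_summable, rule summable_on_comparison_test)
  show "(\<lambda>x. (cmod (coord v x))\<^sup>2 + (cmod (coord w x))\<^sup>2) summable_on UNIV"
    by (intro summable_on_add coord_square_summable)
  fix x
  have "\<bar>inner (coord v x) (coord w x)\<bar> \<le> cmod (coord v x) * cmod (coord w x)"
    by (rule Cauchy_Schwarz_ineq2)
  also have "\<dots> \<le> 2 * cmod (coord v x) * cmod (coord w x)"
    by simp
  also have "\<dots> \<le> (cmod (coord v x))\<^sup>2 + (cmod (coord w x))\<^sup>2"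
    by (rule sum_squares_bound)
  finally show "norm (inner (coord v x) (coord w x)) \<le> (cmod (coord v x))\<^sup>2 + (cmod (coord w x))\<^sup>2"
    by simp
qed auto

instantiation ell2 :: (type) real_vector
begin

lift_definition zero_ell2 :: "'a ell2" is "\<lambda>_. 0" by simp
lift_definition plus_ell2 :: "'a ell2 \<Rightarrow> 'a ell2 \<Rightarrow> 'a ell2" is "\<lambda>f g x. f x + g x"
  by (rule square_summable_add)
lift_definition uminus_ell2 :: "'a ell2 \<Rightarrow> 'a ell2" is "\<lambda>f x. - f x" by simp
lift_definition minus_ell2 :: "'a ell2 \<Rightarrow> 'a ell2 \<Rightarrow> 'a ell2" is "\<lambda>f g x. f x - g x"
  using square_summable_add[of _ "\<lambda>x. - g x" for g] by simp
lift_definition scaleR_ell2 :: "real \<Rightarrow> 'a ell2 \<Rightarrow> 'a ell2" is "\<lambda>r f x. complex_of_real r * f x"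
  by (rule square_summable_mult)

instance
proof
  fix u v w :: "'a ell2" and a b :: real
  show "u + v + w = u + (v + w)" "u + v = v + u" "0 + u = u" "- u + u = 0" "u - v = u + - v"
    "a *\<^sub>R (u + v) = a *\<^sub>R u + a *\<^sub>R v" "(a + b) *\<^sub>R u = a *\<^sub>R u + b *\<^sub>R u"
    "a *\<^sub>R b *\<^sub>R u = (a * b) *\<^sub>R u" "1 *\<^sub>R u = u"
    by (transfer; simp add: algebra_simps fun_eq_iff)+
qed

end

text \<open>Isabelle's \<open>inner\<close> is real: it is the real part of the usual complex inner product
  and induces the same norm.\<close>

instantiation ell2 :: (type) real_inner
begin

definition inner_ell2 :: "'a ell2 \<Rightarrow> 'a ell2 \<Rightarrow> real" where
  "inner_ell2 v w = (\<Sum>\<^sub>\<infinity>x. inner (coord v x) (coord w x))"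
definition norm_ell2 :: "'a ell2 \<Rightarrow> real" where
  "norm_ell2 v = sqrt (\<Sum>\<^sub>\<infinity>x. (cmod (coord v x))\<^sup>2)"
definition sgn_ell2 :: "'a ell2 \<Rightarrow> 'a ell2" where
  "sgn_ell2 v = v /\<^sub>R norm v"
definition dist_ell2 :: "'a ell2 \<Rightarrow> 'a ell2 \<Rightarrow> real" where
  "dist_ell2 v w = norm (v - w)"
definition uniformity_ell2 :: "('a ell2 \<times> 'a ell2) filter" where
  "uniformity_ell2 = (INF e\<in>{0<..}. principal {(v, w). dist v w < e})"
definition open_ell2 :: "'a ell2 set \<Rightarrow> bool" where
  "open_ell2 U = (\<forall>v\<in>U. \<forall>\<^sub>F (v', w) in uniformity. v' = v \<longrightarrow> w \<in> U)"

instance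
proof
  fix u v w :: "'a ell2" and a :: real
  show "sgn u = u /\<^sub>R norm u" "dist u v = norm (u - v)"
    by (simp_all add: sgn_ell2_def dist_ell2_def)
  show "uniformity = (INF e\<in>{0<..}. principal {(v, w :: 'a ell2). dist v w < e})"
    by (rule uniformity_ell2_def)
  show "open U \<longleftrightarrow> (\<forall>v\<in>U. \<forall>\<^sub>F (v', w) in uniformity. v' = v \<longrightarrow> w \<in> U)" for U :: "'a ell2 set"
    by (rule open_ell2_def)
  show "inner u v = inner v u"
    by (simp add: inner_ell2_def inner_commute)
  show "inner (u + v) w = inner u w + inner v w"
    by (simp add: inner_ell2_def plus_ell2.rep_eq inner_add_left infsum_add coord_inner_summable)
  have *: "inner (complex_of_real a * z) z' = a * inner z z'" for z z' :: complex
    by (simp add: inner_complex_def algebra_simps)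
  show "inner (a *\<^sub>R u) v = a * inner u v"
    by (simp add: inner_ell2_def scaleR_ell2.rep_eq * infsum_cmult_right')
  show "0 \<le> inner u u"
    by (simp add: inner_ell2_def infsum_nonneg)
  have "u = 0" if "inner u u = 0"
  proof -
    have "inner (coord u x) (coord u x) = 0" for x
      using nonneg_infsum_le_0D[of "\<lambda>x. inner (coord u x) (coord u x)" UNIV x] that
        coord_inner_summable[of u u] by (simp add: inner_ell2_def)
    then show ?thesis
      by (simp add: coord_inject[symmetric] zero_ell2.rep_eq fun_eq_iff)
  qed
  then show "inner u u = 0 \<longleftrightarrow> u = 0"
    by (auto simp: inner_ell2_def zero_ell2.rep_eq)
  show "norm u = sqrt (inner u u)"
    by (simp add: norm_ell2_def inner_ell2_def power2_norm_eq_inner)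
qed

end

lift_definition cscale :: "complex \<Rightarrow> 'a ell2 \<Rightarrow> 'a ell2" is "\<lambda>c f x. c * f x"
  by (rule square_summable_mult)

lemma norm_cscale: "norm (cscale c v) = cmod c * norm v"
  by (simp add: norm_ell2_def cscale.rep_eq norm_mult power_mult_distrib infsum_cmult_right'
      real_sqrt_mult)

lemma bounded_linear_cscale: "bounded_linear (cscale c)"
proof (rule bounded_linear_intro[where K = "cmod c"])
  show "cscale c (v + w) = cscale c v + cscale c w" "cscale c (r *\<^sub>R v) = r *\<^sub>R cscale c v" for v w r
    by (transfer; simp add: algebra_simps)+
qed (simp add: norm_cscale)

text \<open>Operators are elements of the library type of bounded real-linear maps with the operator norm.
  The operators below are moreover complex-linear, and the operator norm is the same.\<close>

definition op_cscale :: "complex \<Rightarrow> ('a ell2 \<Rightarrow>\<^sub>L 'a ell2) \<Rightarrow> ('a ell2 \<Rightarrow>\<^sub>L 'a ell2)" where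
  "op_cscale c T = Blinfun (cscale c) o\<^sub>L T"

lemma op_cscale_apply: "blinfun_apply (op_cscale c T) v = cscale c (blinfun_apply T v)"
  by (simp add: op_cscale_def bounded_linear_Blinfun_apply bounded_linear_cscale)

section \<open>The reduced group algebra and its traces\<close>

text \<open>The Hilbert space of \<open>G\<close> is the subspace of those elements of \<open>'a ell2\<close> that vanish outside
  \<open>carrier G\<close>.  An operator on this subspace is identified with its extension by 0 on the orthogonal
  complement, which preserves sums, products, and the operator norm.  With this convention
  \<open>reg_rep G g\<close> is the operator of left translation by \<open>g\<close>.\<close>

definition left_translate :: "('a, 'b) monoid_scheme \<Rightarrow> 'a \<Rightarrow> 'a ell2 \<Rightarrow> 'a ell2" where
  "left_translate G g v =
     Abs_ell2 (\<lambda>h. if h \<in> carrier G then coord v (inv\<^bsub>G\<^esub> g \<otimes>\<^bsub>G\<^esub> h) else 0)"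

definition reg_rep :: "('a, 'b) monoid_scheme \<Rightarrow> 'a \<Rightarrow> ('a ell2 \<Rightarrow>\<^sub>L 'a ell2)" where
  "reg_rep G g = Blinfun (left_translate G g)"

context group
begin

lemma left_translate_square_summable:
  assumes "g \<in> carrier G"
  shows "(\<lambda>h. (cmod (coord v (inv g \<otimes> h)))\<^sup>2) summable_on carrier G"
    and "(\<Sum>\<^sub>\<infinity>h\<in>carrier G. (cmod (coord v (inv g \<otimes> h)))\<^sup>2) \<le> (\<Sum>\<^sub>\<infinity>h. (cmod (coord v h))\<^sup>2)"
proof -
  let ?f = "\<lambda>h. (cmod (coord v h))\<^sup>2"
  have inj: "inj_on (\<lambda>h. inv g \<otimes> h) (carrier G)"
    using assms by (auto intro: inj_onI)
  have sub: "?f summable_on (\<lambda>h. inv g \<otimes> h) ` carrier G"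
    using coord_square_summable by (rule summable_on_subset_banach) auto
  then show "(\<lambda>h. (cmod (coord v (inv g \<otimes> h)))\<^sup>2) summable_on carrier G"
    using summable_on_reindex[OF inj, of ?f] by (simp add: o_def)
  have "(\<Sum>\<^sub>\<infinity>h\<in>carrier G. ?f (inv g \<otimes> h)) = infsum ?f ((\<lambda>h. inv g \<otimes> h) ` carrier G)"
    using infsum_reindex[OF inj, of ?f] by (simp add: o_def)
  also have "\<dots> \<le> infsum ?f UNIV"
    by (rule infsum_mono2) (use sub coord_square_summable in auto)
  finally show "(\<Sum>\<^sub>\<infinity>h\<in>carrier G. ?f (inv g \<otimes> h)) \<le> infsum ?f UNIV" .
qed

lemma coord_left_translate:
  assumes "g \<in> carrier G"
  shows "coord (left_translate G g v) h = (if h \<in> carrier G then coord v (inv g \<otimes> h) else 0)"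
proof -
  have "(\<lambda>h. (cmod (if h \<in> carrier G then coord v (inv g \<otimes> h) else 0))\<^sup>2) summable_on UNIV"
    using left_translate_square_summable(1)[OF assms, of v]
    by (rule summable_on_cong_neutral[THEN iffD1, rotated -1]) auto
  then show ?thesis
    by (simp add: left_translate_def Abs_ell2_inverse)
qed

lemma bounded_linear_left_translate:
  assumes "g \<in> carrier G"
  shows "bounded_linear (left_translate G g)"
proof (rule bounded_linear_intro[where K = 1])
  fix v w :: "'a ell2" and r :: real
  show "left_translate G g (v + w) = left_translate G g v + left_translate G g w"
    "left_translate G g (r *\<^sub>R v) = r *\<^sub>R left_translate G g v"
    using assms by (simp_all add: coord_inject[symmetric] coord_left_translate plus_ell2.rep_eq
        scaleR_ell2.rep_eq fun_eq_iff)
  have "(\<Sum>\<^sub>\<infinity>h. (cmod (coord (left_translate G g v) h))\<^sup>2) =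
        (\<Sum>\<^sub>\<infinity>h\<in>carrier G. (cmod (coord v (inv g \<otimes> h)))\<^sup>2)"
    by (rule infsum_cong_neutral) (use assms in \<open>auto simp: coord_left_translate\<close>)
  then show "norm (left_translate G g v) \<le> norm v * 1"
    using left_translate_square_summable(2)[OF assms, of v] by (simp add: norm_ell2_def)
qed

lemma coord_reg_rep:
  assumes "g \<in> carrier G"
  shows "coord (blinfun_apply (reg_rep G g) v) h =
         (if h \<in> carrier G then coord v (inv g \<otimes> h) else 0)"
  using assms by (simp add: reg_rep_def bounded_linear_Blinfun_apply bounded_linear_left_translate
      coord_left_translate)

end

definition group_algebra :: "('a, 'b) monoid_scheme \<Rightarrow> ('a ell2 \<Rightarrow>\<^sub>L 'a ell2) set" where
  "group_algebra G = {(\<Sum>g\<in>F. op_cscale (c g) (reg_rep G g)) | F c. finite F \<and> F \<subseteq> carrier G}"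

definition reduced_cstar :: "('a, 'b) monoid_scheme \<Rightarrow> ('a ell2 \<Rightarrow>\<^sub>L 'a ell2) set" where
  "reduced_cstar G = closure (group_algebra G)"

text \<open>Functionals on the reduced algebra are functions with this domain, in the sense of
  \<open>extensional\<close>: they have a fixed dummy value elsewhere, so that they are equal
  iff they agree on the algebra.\<close>

definition bounded_functionals ::
    "('a, 'b) monoid_scheme \<Rightarrow> (('a ell2 \<Rightarrow>\<^sub>L 'a ell2) \<Rightarrow> complex) set" where
  "bounded_functionals G = {\<phi> \<in> extensional (reduced_cstar G).
     (\<forall>x\<in>reduced_cstar G. \<forall>y\<in>reduced_cstar G. \<phi> (x + y) = \<phi> x + \<phi> y) \<and>
     (\<forall>c. \<forall>x\<in>reduced_cstar G. \<phi> (op_cscale c x) = c * \<phi> x) \<and>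
     (\<exists>K. \<forall>x\<in>reduced_cstar G. cmod (\<phi> x) \<le> K * norm x)}"

definition traces ::
    "('a, 'b) monoid_scheme \<Rightarrow> (('a ell2 \<Rightarrow>\<^sub>L 'a ell2) \<Rightarrow> complex) set" where
  "traces G = {\<tau> \<in> bounded_functionals G.
     \<forall>x\<in>reduced_cstar G. \<forall>y\<in>reduced_cstar G. \<tau> (x o\<^sub>L y) = \<tau> (y o\<^sub>L x)}"

definition is_class_functional ::
    "('a, 'b) monoid_scheme \<Rightarrow> 'a \<Rightarrow> (('a ell2 \<Rightarrow>\<^sub>L 'a ell2) \<Rightarrow> complex) \<Rightarrow> bool" where
  "is_class_functional G g \<phi> \<longleftrightarrow> \<phi> \<in> bounded_functionals G \<and>
     (\<forall>h\<in>carrier G. \<phi> (reg_rep G h) = (if h \<in> conj_class G g then 1 else 0))"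

definition class_functional ::
    "('a, 'b) monoid_scheme \<Rightarrow> 'a \<Rightarrow> ('a ell2 \<Rightarrow>\<^sub>L 'a ell2) \<Rightarrow> complex" where
  "class_functional G g = (THE \<phi>. is_class_functional G g \<phi>)"

end

theory Submission
  imports Defs
begin

text \<open>A trace \<open>\<tau>\<close> is constant on conjugacy classes, so everything rests on \<open>\<tau>(g) = 0\<close> for \<open>g\<close>
  with infinite conjugacy class, and on there being only finitely many elements with finite
  class. Both come from a loxodromic element \<open>b\<close> and some \<open>y\<close> such that \<open>\<langle>b\<rangle>\<close> and \<open>y\<langle>b\<rangle>\<close> have no
  common end: if every \<open>y\<close> preserved an end of \<open>\<langle>b\<rangle>\<close>, then by the pigeonhole principle it would
  commensurate \<open>b\<close>, and \<open>\<langle>b\<rangle>\<close> would have finite index. An element with finite class commutes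
  with powers of \<open>b\<close> and of \<open>y b y\<^sup>-\<^sup>1\<close>, hence moves the coarse centre of a triangle of their
  ends a bounded distance. If the class of \<open>g\<close> is infinite, the two axes yield, for every \<open>n\<close>,
  conjugates \<open>u\<^sub>1, \<dots>, u\<^sub>n\<close> of \<open>g\<close> whose directions are so different that they play ping-pong:
  \<open>u\<^sub>i\<close> maps the complement of the set of \<open>h\<close> sharing more than half of \<open>u\<^sub>i\<^sup>-\<^sup>1\<close> into the set
  of those sharing at least half of \<open>u\<^sub>i\<close>. Therefore \<open>\<parallel>u\<^sub>1 + \<dots> + u\<^sub>n\<parallel> \<le> 2 \<surd>n\<close>, and \<open>n |\<tau>(g)| =
  |\<tau>(u\<^sub>1 + \<dots> + u\<^sub>n)|\<close> grows at most like \<open>\<surd>n\<close>.\<close>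

section \<open>Gromov products in hyperbolic groups\<close>

text \<open>Boundary points never occur. A direction is an initial segment of a geodesic, the Gromov
  product based at \<open>\<one>\<close> measures up to a multiple of \<delta> how long two elements
  share it, and different ends are expressed by bounded products of powers. The arguments about
  directions use only a length with finite balls, splitting of geodesics and the four-point
  inequality, so the geometric realisation serves just to derive these from thin triangles. The
  element \<open>g\<close> may have finite order, so its powers are useless for ping-pong. A long
  conjugate and its inverse moreover start in the same direction, so the attracting set of a
  conjugate meets its repelling set. This does no harm: each conjugate is applied only once, and
  only the attracting sets have to be disjoint from each other, and likewise the repelling ones.
  Conjugates are pushed apart by translation along an axis that avoids their common initial
  direction; any single axis may happen to be that direction, hence the need for two.\<close>

definition gromov :: "('a, 'b) monoid_scheme \<Rightarrow> ('a \<Rightarrow> nat) \<Rightarrow> 'a \<Rightarrow> 'a \<Rightarrow> real" where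
  "gromov G len x y = (real (len x) + real (len y) - real (len (inv\<^bsub>G\<^esub> x \<otimes>\<^bsub>G\<^esub> y))) / 2"

lemma (in group) cancel_left:
  assumes "x \<in> carrier G" "y \<in> carrier G"
  shows "inv x \<otimes> (x \<otimes> y) = y" "x \<otimes> (inv x \<otimes> y) = y"
  using assms by (simp_all flip: m_assoc)

text \<open>\<open>len (inv x \<otimes> y)\<close> is a left-invariant distance, so the base point
  \<open>\<one>\<close> suffices in the four-point inequality. \<open>len_split\<close> stands in
  for geodesics, and \<open>finite_ball\<close> supplies the pigeonholes.\<close>

locale hyperbolic_length = group G for G :: "('a, 'b) monoid_scheme" (structure) +
  fixes len :: "'a \<Rightarrow> nat" and \<delta> :: real
  assumes len_one: "len \<one> = 0"
    and len_inv: "x \<in> carrier G \<Longrightarrow> len (inv x) = len x"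
    and len_mult: "x \<in> carrier G \<Longrightarrow> y \<in> carrier G \<Longrightarrow> len (x \<otimes> y) \<le> len x + len y"
    and finite_ball: "finite {x \<in> carrier G. len x \<le> n}"
    and len_split: "x \<in> carrier G \<Longrightarrow> k \<le> len x \<Longrightarrow>
      \<exists>y\<in>carrier G. \<exists>z\<in>carrier G. x = y \<otimes> z \<and> len y = k \<and> len z = len x - k"
    and four_point: "x \<in> carrier G \<Longrightarrow> y \<in> carrier G \<Longrightarrow> z \<in> carrier G \<Longrightarrow>
      min (gromov G len x y) (gromov G len y z) - \<delta> \<le> gromov G len x z"
begin

abbreviation gp :: "'a \<Rightarrow> 'a \<Rightarrow> real" where "gp \<equiv> gromov G len"

lemma len_mult_real: "x \<in> carrier G \<Longrightarrow> y \<in> carrier G \<Longrightarrow> real (len (x \<otimes> y)) \<le> real (len x) + real (len y)"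
  using len_mult[of x y] by linarith

declare cancel_left [simp]

lemma conj_int_pow:
  assumes "x \<in> carrier G" "y \<in> carrier G"
  shows "(y \<otimes> x \<otimes> inv y) [^] (n::int) = y \<otimes> x [^] n \<otimes> inv y"
proof -
  have "(\<lambda>z. y \<otimes> z \<otimes> inv y) \<in> hom G G"
    using assms by (auto simp: hom_def m_assoc)
  from hom_int_pow[OF this assms(1) is_group is_group] show ?thesis by simp
qed

text \<open>Conjugation by \<open>y\<close> is a homomorphism. Passing to large multiples makes the
  relation visible at large scale.\<close>

lemma commensurating_pow:
  assumes "b \<in> carrier G" "y \<in> carrier G" "y \<otimes> b [^] (s::int) = b [^] (r::int) \<otimes> y"
  shows "y \<otimes> b [^] (s * n) = b [^] (r * n) \<otimes> y"
proof -
  have "y \<otimes> b [^] s \<otimes> inv y = b [^] r" using assms by (simp add: m_assoc)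
  then have "(b [^] r) [^] n = y \<otimes> (b [^] s) [^] n \<otimes> inv y"
    using conj_int_pow[of "b [^] s" y n] assms by simp
  then have "b [^] (r * n) = y \<otimes> b [^] (s * n) \<otimes> inv y" using assms by (simp add: int_pow_pow)
  then show ?thesis using assms by (simp add: m_assoc)
qed

lemma len_int_pow_le:
  assumes "b \<in> carrier G" shows "len (b [^] (i::int)) \<le> nat \<bar>i\<bar> * len b"
proof -
  have n: "len (b [^] (n::nat)) \<le> n * len b" for n
  proof (induction n)
    case (Suc n)
    then show ?case using len_mult[of "b [^] n" b] assms by simp
  qed (simp add: len_one)
  show ?thesis
  proof (cases "0 \<le> i")
    case True
    then show ?thesis using n[of "nat i"] int_pow_int[of G b "nat i"] by simp
  next
    case False
    then have "b [^] i = inv (b [^] nat (- i))"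
      using assms int_pow_neg_int[of b "nat (- i)"] by simp
    then show ?thesis using n[of "nat (- i)"] assms False by (simp add: len_inv)
  qed
qed

lemma gp_commute:
  assumes "x \<in> carrier G" "y \<in> carrier G" shows "gp x y = gp y x"
proof -
  have "inv (inv x \<otimes> y) = inv y \<otimes> x" using assms by (simp add: inv_mult_group)
  then show ?thesis using len_inv[of "inv x \<otimes> y"] assms by (simp add: gromov_def)
qed

lemma gp_nonneg: "x \<in> carrier G \<Longrightarrow> y \<in> carrier G \<Longrightarrow> 0 \<le> gp x y"
  using len_mult[of "inv x" y] by (simp add: gromov_def len_inv)

lemma gp_le_left: assumes "x \<in> carrier G" "y \<in> carrier G" shows "gp x y \<le> len x"
proof -
  have "len y \<le> len x + len (inv x \<otimes> y)"
    using len_mult[of x "inv x \<otimes> y"] assms by simp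
  then show ?thesis by (simp add: gromov_def)
qed

lemma gp_le_right: "x \<in> carrier G \<Longrightarrow> y \<in> carrier G \<Longrightarrow> gp x y \<le> len y"
  using gp_le_left[of y x] gp_commute by simp

lemma gp_self: "x \<in> carrier G \<Longrightarrow> gp x x = len x"
  by (simp add: gromov_def len_one)

lemma delta_nonneg: "0 \<le> \<delta>"
  using four_point[of \<one> \<one> \<one>] by simp

lemma gp_triangle:
  "x \<in> carrier G \<Longrightarrow> y \<in> carrier G \<Longrightarrow> z \<in> carrier G \<Longrightarrow> t \<le> gp x y \<Longrightarrow> t \<le> gp y z \<Longrightarrow> t - \<delta> \<le> gp x z"
  using four_point[of x y z] by linarith

text \<open>The form in which hyperbolicity separates directions: \<open>y\<close> cannot follow
  both \<open>x\<close> and \<open>z\<close> much beyond the point where these part.\<close>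

lemma gp_cases:
  "x \<in> carrier G \<Longrightarrow> y \<in> carrier G \<Longrightarrow> z \<in> carrier G \<Longrightarrow> gp x y \<le> gp x z + \<delta> \<or> gp y z \<le> gp x z + \<delta>"
  using four_point[of x y z] by linarith

text \<open>In the triangle \<open>\<one>\<close>, \<open>u\<close>, \<open>u \<otimes> x\<close>
  the products at the two ends of a side add up to its length, and translation by
  \<open>inv u\<close> turns the one at \<open>u\<close> into \<open>gp x (inv u)\<close>. This is
  the source of ping-pong: \<open>u \<otimes> x\<close> follows \<open>u\<close> unless
  \<open>x\<close> follows \<open>inv u\<close>.\<close>

lemma gp_shift:
  assumes "x \<in> carrier G" "u \<in> carrier G"
  shows "gp (u \<otimes> x) u = len u - gp x (inv u)"
proof -
  have *: "inv (u \<otimes> x) \<otimes> u = inv x" "inv x \<otimes> inv u = inv (u \<otimes> x)"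
    using assms by (simp_all add: inv_mult_group m_assoc)
  show ?thesis
    unfolding gromov_def * using assms by (simp add: len_inv field_simps)
qed

text \<open>Translating both arguments by \<open>u\<close> amounts to moving the base point by the
  distance \<open>len u\<close>.\<close>

lemma gp_translate_le:
  assumes "x \<in> carrier G" "y \<in> carrier G" "u \<in> carrier G"
  shows "gp (u \<otimes> x) (u \<otimes> y) \<le> gp x y + len u"
proof -
  have "inv (u \<otimes> x) \<otimes> (u \<otimes> y) = inv x \<otimes> y"
    using assms by (simp add: inv_mult_group m_assoc)
  then show ?thesis
    using len_mult[of u x] len_mult[of u y] assms by (simp add: gromov_def field_simps)
qed

lemma gp_translate_ge:
  assumes "x \<in> carrier G" "y \<in> carrier G" "u \<in> carrier G"
  shows "gp x y \<le> gp (u \<otimes> x) (u \<otimes> y) + len u"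
  using gp_translate_le[of "u \<otimes> x" "u \<otimes> y" "inv u"] assms by (simp add: len_inv)

lemma gp_mult_right_le:
  assumes "x \<in> carrier G" "y \<in> carrier G" "u \<in> carrier G"
  shows "gp (x \<otimes> u) y \<le> gp x y + len u"
proof -
  have "inv x \<otimes> y = u \<otimes> (inv (x \<otimes> u) \<otimes> y)"
    using assms by (simp add: inv_mult_group m_assoc)
  then show ?thesis
    using len_mult[of u "inv (x \<otimes> u) \<otimes> y"] len_mult[of x u] assms by (simp add: gromov_def field_simps)
qed

lemma len_dist: "real (len (inv x \<otimes> y)) = len x + len y - 2 * gp x y"
  by (simp add: gromov_def field_simps)

subsection \<open>Loxodromic elements\<close>

text \<open>The powers of \<open>b\<close> form a quasi-geodesic line through \<open>\<one>\<close>.\<close>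

definition axial :: "'a \<Rightarrow> real \<Rightarrow> bool" where
  "axial b c \<longleftrightarrow> b \<in> carrier G \<and> (\<forall>(i::int) (j::int). 0 \<le> i \<longrightarrow> j \<le> 0 \<longrightarrow> gp (b [^] i) (b [^] j) \<le> c) \<and>
     (\<forall>i::int. \<bar>i\<bar> \<le> len (b [^] i))"

lemma exists_long:
  assumes "X \<subseteq> carrier G" "infinite X"
  obtains x where "x \<in> X" "len x > n"
proof -
  have "\<not> X \<subseteq> {x \<in> carrier G. len x \<le> n}"
    using finite_subset[OF _ finite_ball] assms(2) by blast
  then show ?thesis using that assms(1) by force
qed

text \<open>In a long geodesic word \<open>y = x z\<close> with halves of equal length, one of \<open>x\<close>, \<open>z\<close> and \<open>y\<close> works: otherwise
  \<open>x\<^sup>-\<^sup>1\<close> and \<open>z\<close> would start in the same direction.\<close>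

lemma exists_turning_element:
  assumes "infinite (carrier G)"
  shows "\<exists>b\<in>carrier G. len b > 2 * gp b (inv b) + 4 * \<delta> + 1"
proof (rule ccontr)
  assume "\<not> ?thesis"
  then have bad: "real (len b) / 2 - (2 * \<delta> + 1) \<le> gp b (inv b)" if "b \<in> carrier G" for b
    using that by force
  \<comment> \<open>Every link of the chain below is at least \<open>m - (2 * \<delta> + 1)\<close>,
    and joining the five links costs \<open>3 * \<delta>\<close>; this \<open>m\<close> keeps the
    result positive.\<close>
  obtain m :: nat where m: "real m > 6 * \<delta> + 1"
    using reals_Archimedean2 by blast
  obtain w where w: "w \<in> carrier G" "len w > 4 * m"
    using exists_long[OF subset_refl assms] by blast
  obtain y where y: "y \<in> carrier G" "len y = 4 * m"
    using len_split[OF w(1), of "4 * m"] w(2) by auto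
  obtain x z where x: "x \<in> carrier G" "len x = 2 * m" and z: "z \<in> carrier G" "len z = 2 * m" and yxz: "y = x \<otimes> z"
    using len_split[OF y(1), of "2 * m"] y(2) by auto
  let ?t = "real m - (2 * \<delta> + 1)"
  \<comment> \<open>Neighbours in the chain \<open>inv x\<close>, \<open>x\<close>,
    \<open>y\<close>, \<open>inv y\<close>, \<open>inv z\<close>, \<open>z\<close> share a long
    initial segment: links 1, 3, 5 by \<open>bad\<close>, links 2 and 4 because \<open>x\<close>
    begins the geodesic \<open>y\<close> and \<open>inv z\<close> begins
    \<open>inv y\<close>.\<close>
  have 1: "?t \<le> gp (inv x) x" using bad[OF x(1)] x gp_commute by simp
  have 2: "?t \<le> gp x y"
  proof -
    have "inv x \<otimes> y = z" using x z yxz by simp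
    then show ?thesis using x y z delta_nonneg by (simp add: gromov_def)
  qed
  have 3: "?t \<le> gp y (inv y)" using bad[OF y(1)] y by simp
  have 4: "?t \<le> gp (inv y) (inv z)"
  proof -
    have "inv (inv y) \<otimes> inv z = x" using x z yxz by (simp add: m_assoc)
    then show ?thesis unfolding gromov_def using x y z delta_nonneg by (simp add: len_inv)
  qed
  have 5: "?t \<le> gp (inv z) z" using bad[OF z(1)] z gp_commute by simp
  note d = delta_nonneg
  have a: "?t - \<delta> \<le> gp (inv x) y" using gp_triangle[OF _ _ _ 1 2] x y by simp
  have "?t - \<delta> \<le> gp (inv y) z" using gp_triangle[OF _ _ _ 4 5] y z by simp
  then have b: "?t - \<delta> - \<delta> \<le> gp y z" using gp_triangle[of y "inv y" z "?t - \<delta>"] 3 d y z by simp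
  have "?t - 3 * \<delta> \<le> gp (inv x) z" using gp_triangle[of "inv x" y z "?t - 2 * \<delta>"] a b d x y z by simp
  \<comment> \<open>As the product \<open>x \<otimes> z\<close> is geodesic, \<open>inv x\<close>
    and \<open>z\<close> leave \<open>\<one>\<close> in opposite directions.\<close>
  moreover have "gp (inv x) z = 0"
    using x z y yxz by (simp add: gromov_def len_inv)
  ultimately show False using m d by simp
qed

text \<open>A local condition becomes global: by \<open>gp_shift\<close> each further power follows
  \<open>b\<close> for most of its length, and since \<open>b\<close> and \<open>inv b\<close> part
  at \<open>c\<close>, it cannot turn back along \<open>inv b\<close>. \<open>P\<close> and
  \<open>Q\<close> propagate this through positive and negative powers, and \<open>R\<close>
  combines them. Lengths grow because \<open>len b\<close> exceeds \<open>2 * (c + \<delta>)\<close>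
  by more than 1.\<close>

lemma exists_axial:
  assumes "infinite (carrier G)"
  shows "\<exists>b c. axial b c"
proof -
  obtain b where b: "b \<in> carrier G" and big: "len b > 2 * gp b (inv b) + 4 * \<delta> + 1"
    using exists_turning_element[OF assms] by blast
  define c where "c = gp b (inv b)"
  note d = delta_nonneg
  have neg: "b [^] (- int n) = inv (b [^] int n)" for n
    using b by (simp add: int_pow_neg)
  have suc: "b [^] int (Suc n) = b \<otimes> b [^] int n" for n
    using b int_pow_mult[of b 1 "int n"] by simp
  have sucn: "b [^] (- int (Suc n)) = inv b \<otimes> b [^] (- int n)" for n
    using b int_pow_mult[of b "-1" "- int n"] by (simp add: int_pow_neg)
  have c0: "0 \<le> c" unfolding c_def using b gp_nonneg by simp
  have big': "len b > 2 * c + 4 * \<delta> + 1" using big by (simp add: c_def)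
  have P: "gp (inv b) (b [^] int n) \<le> c + \<delta>" for n
  proof (induction n)
    case 0 then show ?case using b c0 d gp_le_right[of "inv b" \<one>] by (simp add: len_one)
  next
    case (Suc n)
    have "gp (b [^] int (Suc n)) b = len b - gp (b [^] int n) (inv b)"
      unfolding suc using b by (simp add: gp_shift)
    then have "gp (b [^] int (Suc n)) b \<ge> len b - (c + \<delta>)"
      using Suc gp_commute b by simp
    moreover have "min (gp (inv b) (b [^] int (Suc n))) (gp (b [^] int (Suc n)) b) - \<delta> \<le> c"
      using four_point[of "inv b" "b [^] int (Suc n)" b] b gp_commute by (simp add: c_def)
    ultimately show ?case using big' d by linarith
  qed
  have Q: "gp b (b [^] (- int n)) \<le> c + \<delta>" for n
  proof (induction n)
    case 0 then show ?case using b c0 d gp_le_right[of b \<one>] by (simp add: len_one)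
  next
    case (Suc n)
    have "gp (b [^] (- int (Suc n))) (inv b) = len b - gp (b [^] (- int n)) b"
      unfolding sucn using b gp_shift[of "b [^] (- int n)" "inv b"] by (simp add: len_inv)
    then have "gp (b [^] (- int (Suc n))) (inv b) \<ge> len b - (c + \<delta>)"
      using Suc gp_commute b by simp
    moreover have "min (gp b (b [^] (- int (Suc n)))) (gp (b [^] (- int (Suc n))) (inv b)) - \<delta> \<le> c"
      using four_point[of b "b [^] (- int (Suc n))" "inv b"] b by (simp add: c_def)
    ultimately show ?case using big' d by linarith
  qed
  have R: "gp (b [^] (- int p)) (b [^] int q) \<le> c + 2 * \<delta>" for p q
  proof (cases p)
    case 0 then show ?thesis using b c0 d gp_le_left[of \<one> "b [^] int q"] by (simp add: len_one)
  next
    case (Suc p')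
    have "gp (b [^] (- int p)) (inv b) = len b - gp (b [^] (- int p')) b"
      unfolding Suc sucn using b gp_shift[of "b [^] (- int p')" "inv b"] by (simp add: len_inv)
    then have "gp (inv b) (b [^] (- int p)) \<ge> len b - (c + \<delta>)"
      using Q[of p'] gp_commute b by simp
    moreover have "min (gp (inv b) (b [^] (- int p))) (gp (b [^] (- int p)) (b [^] int q)) - \<delta> \<le> c + \<delta>"
      using four_point[of "inv b" "b [^] (- int p)" "b [^] int q"] b P[of q] by simp
    ultimately show ?thesis using big' d by linarith
  qed
  have L: "n \<le> len (b [^] int n)" for n
  proof (induction n)
    case (Suc n)
    have "real (len (b [^] int (Suc n))) = len b + len (b [^] int n) - 2 * gp (inv b) (b [^] int n)"
      using b len_dist[of "inv b" "b [^] int n"] suc[of n] by (simp add: len_inv)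
    then have "real (len (b [^] int (Suc n))) > len (b [^] int n)"
      using P[of n] big' d by linarith
    then show ?case using Suc by simp
  qed simp
  have "axial b (c + 2 * \<delta>)"
    unfolding axial_def
  proof (intro conjI allI impI b)
    fix i j :: int assume "0 \<le> i" "j \<le> 0"
    then obtain p q where "i = int q" "j = - int p" by (metis nonneg_int_cases nonpos_int_cases)
    then show "gp (b [^] i) (b [^] j) \<le> c + 2 * \<delta>" using R[of p q] gp_commute b by simp
  next
    fix i :: int
    show "\<bar>i\<bar> \<le> len (b [^] i)"
    proof (cases "0 \<le> i")
      case True then show ?thesis using L[of "nat i"] by simp
    next
      case False
      then have "b [^] i = inv (b [^] int (nat (-i)))" using neg[of "nat (-i)"] by simp
      then show ?thesis using L[of "nat (-i)"] len_inv b False by simp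
    qed
  qed
  then show ?thesis by blast
qed

context
  fixes b c assumes ax: "axial b c"
begin

lemma axial_carrier [simp]: "b \<in> carrier G" using ax by (simp add: axial_def)

lemma axial_len: "\<bar>i\<bar> \<le> int (len (b [^] i))" using ax by (simp add: axial_def)

lemma axial_opposite: "0 \<le> (i::int) \<Longrightarrow> (j::int) \<le> 0 \<Longrightarrow> gp (b [^] i) (b [^] j) \<le> c"
  using ax by (simp add: axial_def)

lemma axial_nonneg: "0 \<le> c"
  using axial_opposite[of 0 0] by (simp add: gp_self len_one)

text \<open>Seen from \<open>b [^] i\<close>, the points \<open>\<one>\<close> and
  \<open>b [^] j\<close> are powers of opposite signs, so \<open>b [^] i\<close> lies almost on a
  geodesic between them.\<close>

lemma axial_same:
  assumes "(0 \<le> i \<and> i \<le> j) \<or> (j \<le> i \<and> i \<le> (0::int))"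
  shows "len (b [^] i) - c \<le> gp (b [^] i) (b [^] j)"
proof -
  have e: "b [^] j = b [^] i \<otimes> b [^] (j - i)" by (simp flip: int_pow_mult)
  have "gp (b [^] j) (b [^] i) = len (b [^] i) - gp (b [^] (j - i)) (b [^] (- i))"
    unfolding e by (simp add: gp_shift int_pow_neg)
  moreover have "gp (b [^] (j - i)) (b [^] (- i)) \<le> c"
  proof (cases "0 \<le> i \<and> i \<le> j")
    case True then show ?thesis by (intro axial_opposite) auto
  next
    case False
    then have "gp (b [^] (- i)) (b [^] (j - i)) \<le> c" using assms by (intro axial_opposite) auto
    then show ?thesis by (simp add: gp_commute)
  qed
  ultimately show ?thesis by (simp add: gp_commute)
qed

section \<open>Elements commensurating a loxodromic element\<close>

text \<open>By hypothesis \<open>\<one>\<close> is a nearest point of the axis to \<open>z\<close>.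
  If \<open>z\<close> followed the axis for long, the power at about the depth where they part would
  be nearer.\<close>

lemma axial_nearest:
  assumes z: "z \<in> carrier G" and min: "\<And>m::int. len z \<le> len (b [^] m \<otimes> z)"
  shows "gp z (b [^] (m::int)) \<le> len b + 2 * c + 2 * \<delta>"
proof (rule ccontr)
  define t where "t = gp z (b [^] m)"
  assume "\<not> ?thesis"
  then have t: "t > len b + 2 * c + 2 * \<delta>" by (simp add: t_def)
  \<comment> \<open>The first step along the axis whose length reaches \<open>t\<close>. One step
    adds at most \<open>len b\<close>, so the overshoot is smaller than that.\<close>
  define k where "k = (LEAST k::nat. t \<le> len (b [^] (sgn m * int k)))"
  have ex: "t \<le> len (b [^] (sgn m * int (nat \<bar>m\<bar>)))"
    unfolding t_def using gp_le_right[of z "b [^] m"] z by (simp add: sgn_mult_abs)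
  have k1: "t \<le> len (b [^] (sgn m * int k))" unfolding k_def using ex by (rule LeastI)
  have k2: "k \<le> nat \<bar>m\<bar>" unfolding k_def using ex by (rule Least_le)
  have c: "0 \<le> c" by (rule axial_nonneg)
  have "k \<noteq> 0"
  proof
    assume "k = 0"
    then have "t \<le> 0" using k1 by (simp add: len_one)
    then show False using t c delta_nonneg by linarith
  qed
  then obtain k' where k': "k = Suc k'" by (cases k) auto
  then have "\<not> t \<le> len (b [^] (sgn m * int k'))"
    using not_less_Least[of k' "\<lambda>k. t \<le> len (b [^] (sgn m * int k))"] k_def by simp
  moreover have "len (b [^] (sgn m * int k)) \<le> len (b [^] (sgn m * int k')) + len b"
  proof -
    have e: "b [^] (sgn m * int k) = b [^] (sgn m * int k') \<otimes> b [^] (sgn m)"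
      unfolding k' by (simp add: algebra_simps flip: int_pow_mult)
    have "len (b [^] (sgn m)) \<le> len b"
      by (cases "m = 0"; cases "m > 0") (auto simp: len_one int_pow_neg len_inv)
    then show ?thesis unfolding e using len_mult[of "b [^] (sgn m * int k')" "b [^] (sgn m)"] by simp
  qed
  ultimately have k3: "len (b [^] (sgn m * int k)) < t + len b" by linarith
  let ?i = "sgn m * int k"
  have "len (b [^] ?i) - c \<le> gp (b [^] ?i) (b [^] m)"
    by (rule axial_same) (use k2 in \<open>auto simp: sgn_if\<close>)
  then have "t - c \<le> gp (b [^] m) (b [^] ?i)" using k1 gp_commute by simp
  moreover have "t - c \<le> gp z (b [^] m)" using c by (simp add: t_def)
  ultimately have "t - c - \<delta> \<le> gp z (b [^] ?i)" using gp_triangle[of z "b [^] m" "b [^] ?i"] z by simp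
  then have "real (len (inv (b [^] ?i) \<otimes> z)) < len z"
    using len_dist[of "b [^] ?i" z] k3 t z gp_commute by simp
  moreover have "len z \<le> len (inv (b [^] ?i) \<otimes> z)" using min[of "- ?i"] by (simp add: int_pow_neg)
  ultimately show False by simp
qed

text \<open>A large multiple of the relation gives one element that follows a power of
  \<open>b\<close>, being within \<open>len y\<close> of it, and also follows \<open>y\<close>
  almost to its end. But \<open>y\<close>, shortest in its double coset, does not follow the
  axis.\<close>

lemma commensurating_short:
  assumes y: "y \<in> carrier G" and min: "\<And>(i::int) (j::int). len y \<le> len (b [^] i \<otimes> y \<otimes> b [^] j)"
    and rs: "y \<otimes> b [^] (s::int) = b [^] (r::int) \<otimes> y" "r \<noteq> 0"
  shows "len y \<le> 2 * (len b + 2 * c + 2 * \<delta>) + \<delta>"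
proof -
  let ?C = "len b + 2 * c + 2 * \<delta>"
  have m1: "gp y (b [^] m) \<le> ?C" for m :: int
    using axial_nearest[OF y] min[of _ 0] y by simp
  have m2: "gp (inv y) (b [^] (m::int)) \<le> ?C" for m
  proof (rule axial_nearest)
    fix k :: int
    have "inv (b [^] k \<otimes> inv y) = y \<otimes> b [^] (- k)" using y by (simp add: inv_mult_group int_pow_neg)
    then have "len (b [^] k \<otimes> inv y) = len (y \<otimes> b [^] (- k))"
      using len_inv[of "b [^] k \<otimes> inv y"] y by simp
    then show "len (inv y) \<le> len (b [^] k \<otimes> inv y)" using min[of 0 "- k"] y by (simp add: len_inv)
  qed (use y in simp)
  \<comment> \<open>The factor 2 makes \<open>X\<close> at least twice as long as \<open>y\<close>,
    so that \<open>X\<close> and \<open>X \<otimes> y\<close>, which are \<open>len y\<close> apart,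
    share at least \<open>len y\<close>.\<close>
  let ?n = "2 * int (len y)"
  define X where "X = b [^] (r * ?n)"
  have Xc: "X \<in> carrier G" by (simp add: X_def)
  have Xy: "y \<otimes> b [^] (s * ?n) = X \<otimes> y" unfolding X_def by (rule commensurating_pow[OF axial_carrier y rs(1)])
  have "1 \<le> \<bar>r\<bar>" using rs(2) by linarith
  then have "2 * int (len y) \<le> \<bar>r * ?n\<bar>" using mult_right_mono[of 1 "\<bar>r\<bar>" ?n] by (simp add: abs_mult)
  then have "2 * real (len y) \<le> len X" using axial_len[of "r * ?n"] unfolding X_def by linarith
  moreover have "real (len X) \<le> real (len (X \<otimes> y)) + real (len y)"
    using len_mult_real[of "X \<otimes> y" "inv y"] y Xc by (simp add: m_assoc len_inv)
  moreover have "gp X (X \<otimes> y) = (real (len X) + len (X \<otimes> y) - len y) / 2"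
    using y Xc by (simp add: gromov_def)
  ultimately have 1: "len y \<le> gp X (X \<otimes> y)" by (simp add: field_simps)
  have "gp (y \<otimes> b [^] (s * ?n)) y = len y - gp (b [^] (s * ?n)) (inv y)"
    using y by (simp add: gp_shift)
  then have 2: "len y - ?C \<le> gp (X \<otimes> y) y"
    using m2[of "s * ?n"] Xy y gp_commute[of "inv y" "b [^] (s * ?n)"] by simp
  have "len y - ?C - \<delta> \<le> gp X y"
    by (rule gp_triangle[OF _ _ _ _ 2]) (use 1 y Xc axial_nonneg delta_nonneg in auto)
  then show ?thesis using m1[of "r * ?n"] gp_commute[of y X] y Xc unfolding X_def by simp
qed

text \<open>Along a common stretch, corresponding points of the two axes stay close, so the
  quotients \<open>h k\<close> lie in a fixed ball. A stretch with more steps than the ball has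
  elements repeats a value, and the repetition is the relation.\<close>

lemma commensurating_if_unbounded:
  assumes y: "y \<in> carrier G" and unb: "\<And>t. \<exists>(i::int) (j::int). t < gp (b [^] i) (y \<otimes> b [^] j)"
  shows "\<exists>(r::int) (s::int). r \<noteq> 0 \<and> y \<otimes> b [^] s = b [^] r \<otimes> y"
proof -
  \<comment> \<open>Bound for \<open>len (h k)\<close>: one point has length \<open>?L\<close>, the
    other at most \<open>?L + len y\<close>, and they share at least
    \<open>?L - c - len y - 2 * \<delta>\<close>.\<close>
  define C where "C = 2 * c + 3 * len y + 4 * \<delta>"
  define B where "B = {x \<in> carrier G. len x \<le> nat \<lfloor>C\<rfloor>}"
  have B: "finite B" unfolding B_def by (rule finite_ball)
  define N where "N = card B"
  \<comment> \<open>Forces both exponents to exceed \<open>N\<close> in absolute value, where the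
    summand \<open>len y\<close> pays for the prefix \<open>y\<close>, and bounds the length of the
    first \<open>N\<close> powers.\<close>
  define t where "t = real (N * len b + len y)"
  obtain i j :: int where ij: "t < gp (b [^] i) (y \<otimes> b [^] j)" using unb by blast
  have "t < len (b [^] i)" using ij gp_le_left[of "b [^] i" "y \<otimes> b [^] j"] y by simp
  also have "real (len (b [^] i)) \<le> nat \<bar>i\<bar> * len b" using len_int_pow_le[of b i] by (metis axial_carrier of_nat_mono)
  finally have "N * len b < nat \<bar>i\<bar> * len b" unfolding t_def by linarith
  then have i: "N < nat \<bar>i\<bar>" by simp
  have "t < len (y \<otimes> b [^] j)" using ij gp_le_right[of "b [^] i" "y \<otimes> b [^] j"] y by simp
  also have "real (len (y \<otimes> b [^] j)) \<le> real (len y + nat \<bar>j\<bar> * len b)"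
    using len_int_pow_le[of b j] len_mult[of y "b [^] j"] y by (simp del: of_nat_add of_nat_mult)
  finally have "N * len b < nat \<bar>j\<bar> * len b" unfolding t_def by linarith
  then have j: "N < nat \<bar>j\<bar>" by simp
  \<comment> \<open>The signs select the ends at which the two axes run together.\<close>
  define h where "h k = inv (b [^] (sgn i * int k)) \<otimes> (y \<otimes> b [^] (sgn j * int k))" for k
  have sgnlen: "len (b [^] (sgn l * int k)) = len (b [^] int k)" if "l \<noteq> 0" for l k
    using that by (cases "l > 0") (auto simp: int_pow_neg len_inv)
  have "h ` {..N} \<subseteq> B"
  proof safe
    fix k assume k: "k \<le> N"
    let ?P = "b [^] (sgn i * int k)" and ?Q = "b [^] (sgn j * int k)"
    let ?L = "real (len (b [^] int k))"
    have L: "len ?P = ?L" "len ?Q = ?L" using sgnlen i j by auto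
    have Lt: "?L \<le> t"
    proof -
      have "len (b [^] int k) \<le> k * len b" using len_int_pow_le[of b "int k"] by simp
      also have "\<dots> \<le> N * len b" using k by simp
      finally have "len (b [^] int k) \<le> N * len b + len y" by simp
      then show ?thesis unfolding t_def by (rule of_nat_mono)
    qed
    have "?L - c \<le> gp ?P (b [^] i)"
      unfolding L(1)[symmetric] by (rule axial_same) (use i k in \<open>auto simp: sgn_if\<close>)
    moreover have "?L - c \<le> gp ?Q (b [^] j)"
      unfolding L(2)[symmetric] by (rule axial_same) (use j k in \<open>auto simp: sgn_if\<close>)
    then have "?L - c - len y \<le> gp (y \<otimes> ?Q) (y \<otimes> b [^] j)"
      using gp_translate_ge[of ?Q "b [^] j" y] y by simp
    ultimately have "?L - c - len y - \<delta> - \<delta> \<le> gp ?P (y \<otimes> ?Q)"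
      using ij Lt y axial_nonneg delta_nonneg
      by (intro gp_triangle[of ?P "y \<otimes> b [^] j"] gp_triangle[of ?P "b [^] i"])
         (auto simp: gp_commute)
    moreover have "len (y \<otimes> ?Q) \<le> len y + ?L" using len_mult[of y ?Q] y L by simp
    ultimately have "len (h k) \<le> C"
      unfolding h_def C_def using len_dist[of ?P "y \<otimes> ?Q"] L by linarith
    then show "h k \<in> B" unfolding B_def using y by (auto simp: h_def le_nat_floor)
  qed
  then have "card (h ` {..N}) \<le> N" unfolding N_def using B card_mono by blast
  then have "\<not> inj_on h {..N}" using card_image[of h "{..N}"] by auto
  then obtain k l where kl: "k \<noteq> l" "h k = h l" by (auto simp: inj_on_def)
  have pw: "b [^] (p * (int k - int l)) = b [^] (p * int k) \<otimes> inv (b [^] (p * int l))" for p :: int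
    by (simp add: right_diff_distrib int_pow_diff)
  let ?bi = "\<lambda>k. b [^] (sgn i * int k)" and ?bj = "\<lambda>k. b [^] (sgn j * int k)"
  have "y \<otimes> ?bj k = ?bi k \<otimes> h k" unfolding h_def using y by simp
  also have "\<dots> = ?bi k \<otimes> inv (?bi l) \<otimes> y \<otimes> ?bj l"
    unfolding kl(2) unfolding h_def using y by (simp add: m_assoc)
  finally have "y \<otimes> ?bj k \<otimes> inv (?bj l) = ?bi k \<otimes> inv (?bi l) \<otimes> y"
    using y by (simp add: m_assoc)
  then have "y \<otimes> b [^] (sgn j * (int k - int l)) = b [^] (sgn i * (int k - int l)) \<otimes> y"
    unfolding pw using y by (simp add: m_assoc)
  moreover have "sgn i * (int k - int l) \<noteq> 0" using kl i by (auto simp: sgn_if)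
  ultimately show ?thesis by blast
qed

text \<open>Each double coset of \<open>H\<close> has a shortest, hence short, element
  \<open>w\<close>, so there are finitely many of them. The relation moves multiples of
  \<open>s w\<close> across \<open>w\<close> into \<open>H\<close>, so finitely many cosets
  \<open>H #> (w \<otimes> b [^] q)\<close> fill the double coset.\<close>

lemma elementary_if_commensurating:
  assumes comm: "\<And>y. y \<in> carrier G \<Longrightarrow> \<exists>(r::int) (s::int). r \<noteq> 0 \<and> y \<otimes> b [^] s = b [^] r \<otimes> y"
  shows "elementary G"
proof -
  define H where "H = range (\<lambda>i::int. b [^] i)"
  have sub: "subgroup H G"
  proof (rule subgroupI)
    show "inv a \<in> H" if "a \<in> H" for a
      using that unfolding H_def by (auto simp flip: int_pow_neg)
    show "x \<otimes> y \<in> H" if "x \<in> H" "y \<in> H" for x y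
      using that unfolding H_def by (auto simp flip: int_pow_mult)
  qed (auto simp: H_def)
  have inj: "inj (\<lambda>i::int. b [^] i)"
  proof (rule injI)
    fix i j :: int assume "b [^] i = b [^] j"
    then have "b [^] (i - j) = \<one>" by (simp add: int_pow_diff)
    then show "i = j" using axial_len[of "i - j"] by (simp add: len_one)
  qed
  have "(\<lambda>i::int. b [^] i) \<in> iso integer_group (G\<lparr>carrier := H\<rparr>)"
    using inj by (auto simp: iso_def hom_def bij_betw_def H_def int_pow_mult)
  then have iso: "G\<lparr>carrier := H\<rparr> \<cong> integer_group"
    using group.iso_sym[OF group_integer_group] by (auto simp: is_iso_def)
  define C where "C = 2 * (len b + 2 * c + 2 * \<delta>) + \<delta>"
  define W where "W = {x \<in> carrier G. len x \<le> nat \<lfloor>C\<rfloor>}"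
  have W: "finite W" unfolding W_def by (rule finite_ball)
  have "\<forall>y\<in>carrier G. \<exists>s::int. s \<noteq> 0 \<and> (\<exists>r::int. r \<noteq> 0 \<and> y \<otimes> b [^] s = b [^] r \<otimes> y)"
  proof
    fix y assume y: "y \<in> carrier G"
    then obtain r s :: int where rs: "r \<noteq> 0" "y \<otimes> b [^] s = b [^] r \<otimes> y" using comm by blast
    have "s \<noteq> 0"
    proof
      assume "s = 0"
      then have "b [^] r = \<one>" using rs(2) y by simp
      then show False using axial_len[of r] rs(1) by (simp add: len_one)
    qed
    then show "\<exists>s::int. s \<noteq> 0 \<and> (\<exists>r::int. r \<noteq> 0 \<and> y \<otimes> b [^] s = b [^] r \<otimes> y)" using rs by blast
  qed
  then obtain s :: "'a \<Rightarrow> int" where s: "\<And>y. y \<in> carrier G \<Longrightarrow> s y \<noteq> 0"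
      "\<And>y. y \<in> carrier G \<Longrightarrow> \<exists>r::int. r \<noteq> 0 \<and> y \<otimes> b [^] s y = b [^] r \<otimes> y"
    by metis
  have "rcosets H \<subseteq> (\<lambda>(w, q). H #> (w \<otimes> b [^] q)) ` (SIGMA w:W. {0..<\<bar>s w\<bar>})"
  proof
    fix X assume "X \<in> rcosets H"
    then obtain y where y: "y \<in> carrier G" "X = H #> y" by (auto simp: RCOSETS_def)
    obtain ij :: "int \<times> int" where ij: "\<And>kl :: int \<times> int.
        len (b [^] fst ij \<otimes> y \<otimes> b [^] snd ij) \<le> len (b [^] fst kl \<otimes> y \<otimes> b [^] snd kl)"
      using ex_has_least_nat[of "\<lambda>_ :: int \<times> int. True" _ "\<lambda>ij. len (b [^] fst ij \<otimes> y \<otimes> b [^] snd ij)"]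
      by blast
    obtain i j where ij': "ij = (i, j)" by fastforce
    define w where "w = b [^] i \<otimes> y \<otimes> b [^] j"
    have wc: "w \<in> carrier G" using y by (simp add: w_def)
    have wmin: "len w \<le> len (b [^] k \<otimes> w \<otimes> b [^] l)" for k l :: int
    proof -
      have "b [^] k \<otimes> w \<otimes> b [^] l = b [^] (k + i) \<otimes> y \<otimes> b [^] (j + l)"
        using y by (simp add: w_def m_assoc int_pow_mult)
      then show ?thesis using ij[of "(k + i, j + l)"] by (simp add: ij' w_def)
    qed
    obtain r :: int where r: "r \<noteq> 0" "w \<otimes> b [^] s w = b [^] r \<otimes> w" using s(2)[OF wc] by blast
    have "len w \<le> C" unfolding C_def using commensurating_short[OF wc wmin r(2,1)] .
    then have "w \<in> W" using wc by (simp add: W_def le_nat_floor)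
    \<comment> \<open>Remainders modulo \<open>\<bar>s w\<bar>\<close> range over a finite set; the
      sign in \<open>p\<close> turns the quotient into a multiple of \<open>s w\<close> itself,
      which may be negative.\<close>
    define q where "q = (- j) mod \<bar>s w\<bar>"
    define p where "p = sgn (s w) * ((- j) div \<bar>s w\<bar>)"
    have "s w * p = \<bar>s w\<bar> * ((- j) div \<bar>s w\<bar>)"
      unfolding p_def by (simp add: abs_sgn)
    then have jq: "- j = s w * p + q" unfolding q_def by (simp add: minus_mod_eq_mult_div[symmetric])
    have "y = b [^] (- i) \<otimes> w \<otimes> b [^] (- j)" unfolding w_def using y by (simp add: m_assoc int_pow_neg)
    also have "\<dots> = b [^] (- i) \<otimes> (w \<otimes> b [^] (s w * p)) \<otimes> b [^] q"
      unfolding jq using wc by (simp add: m_assoc int_pow_mult)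
    also have "\<dots> = (b [^] (- i) \<otimes> b [^] (r * p)) \<otimes> (w \<otimes> b [^] q)"
      unfolding commensurating_pow[OF axial_carrier wc r(2)] using wc by (simp add: m_assoc)
    also have "b [^] (- i) \<otimes> b [^] (r * p) = b [^] (- i + r * p)" by (simp only: int_pow_mult axial_carrier)
    finally have "y = b [^] (- i + r * p) \<otimes> (w \<otimes> b [^] q)" .
    then have "H #> y = (H #> b [^] (- i + r * p)) #> (w \<otimes> b [^] q)"
      using wc subgroup.subset[OF sub] by (simp add: coset_mult_assoc)
    also have "H #> b [^] (- i + r * p) = H"
      using coset_join2[OF _ sub] by (simp add: H_def)
    finally have "X = H #> (w \<otimes> b [^] q)" by (simp add: y)
    moreover have "q \<in> {0..<\<bar>s w\<bar>}" unfolding q_def using s(1)[OF wc] by simp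
    ultimately show "X \<in> (\<lambda>(w, q). H #> (w \<otimes> b [^] q)) ` (SIGMA w:W. {0..<\<bar>s w\<bar>})"
      using \<open>w \<in> W\<close> by (intro image_eqI[of _ _ "(w, q)"]) auto
  qed
  then have "finite (rcosets H)" by (rule finite_subset) (use W in auto)
  then show ?thesis unfolding elementary_def using sub iso by blast
qed

end

section \<open>A pair of separated axes\<close>

lemma axial_mono: "axial b c \<Longrightarrow> c \<le> c' \<Longrightarrow> axial b c'"
  unfolding axial_def by (meson order_trans)

lemma exists_separated_axes:
  assumes "infinite (carrier G)" "\<not> elementary G"
  obtains b c y where "axial b c" "y \<in> carrier G"
    "\<And>(i::int) (j::int). gp (b [^] i) (y \<otimes> b [^] j) \<le> c"
proof -
  obtain b c where ax: "axial b c" using exists_axial[OF assms(1)] by blast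
  obtain y where y: "y \<in> carrier G"
    and no: "\<not> (\<exists>(r::int) (s::int). r \<noteq> 0 \<and> y \<otimes> b [^] s = b [^] r \<otimes> y)"
    using assms(2) elementary_if_commensurating[OF ax] by metis
  have "\<exists>t. \<forall>(i::int) (j::int). gp (b [^] i) (y \<otimes> b [^] j) \<le> t"
  proof (rule ccontr)
    assume "\<not> ?thesis"
    then have "\<exists>(i::int) (j::int). t < gp (b [^] i) (y \<otimes> b [^] j)" for t by (meson not_le)
    from commensurating_if_unbounded[OF ax y this] no show False by simp
  qed
  then obtain t where t: "\<And>(i::int) (j::int). gp (b [^] i) (y \<otimes> b [^] j) \<le> t" by blast
  show ?thesis
    by (rule that[of b "max c t" y]) (use ax y t in \<open>auto intro: axial_mono simp: le_max_iff_disj\<close>)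
qed

subsection \<open>Finite and infinite conjugacy classes\<close>

text \<open>The conjugates of \<open>f\<close> by powers of \<open>x\<close> lie in a finite set, so
  two different powers give the same conjugate.\<close>

lemma commute_pow_if_finite_class:
  assumes f: "f \<in> carrier G" "finite (conj_class G f)" and x: "x \<in> carrier G"
  shows "\<exists>k::int. k \<noteq> 0 \<and> f \<otimes> x [^] k = x [^] k \<otimes> f"
proof -
  let ?h = "\<lambda>n::int. x [^] n \<otimes> f \<otimes> inv (x [^] n)"
  have "range ?h \<subseteq> conj_class G f" using x by (auto simp: conj_class_def)
  then have "finite (range ?h)" using f(2) finite_subset by blast
  then have "\<not> inj ?h" using finite_imageD infinite_UNIV_int by blast
  then obtain m n where mn: "m \<noteq> n" "?h m = ?h n" by (auto simp: inj_on_def)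
  have "x [^] (m - n) = inv (x [^] n) \<otimes> x [^] m"
    using x int_pow_mult[of x "- n" m] by (simp add: int_pow_neg)
  then have "x [^] (m - n) \<otimes> f = inv (x [^] n) \<otimes> ?h m \<otimes> x [^] m"
    using f x by (simp add: m_assoc)
  also have "\<dots> = f \<otimes> x [^] (m - n)"
    unfolding mn(2) \<open>x [^] (m - n) = _\<close> using f x by (simp add: m_assoc)
  finally show ?thesis using mn(1) by (intro exI[of _ "m - n"]) simp
qed

text \<open>By \<open>gp_shift\<close> both \<open>inv f \<otimes> P\<close> and
  \<open>inv f \<otimes> Q\<close> follow \<open>inv f\<close> for
  \<open>len f - c - \<delta>\<close>, hence follow each other. At this depth they agree with
  \<open>P\<close> and \<open>Q\<close>, which part at \<open>c\<close>; the three transitions cost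
  \<open>3 * \<delta>\<close>.\<close>

lemma len_le_if_median:
  assumes car: "f \<in> carrier G" "P \<in> carrier G" "Q \<in> carrier G"
    and "gp P Q \<le> c" "gp f P \<le> c + \<delta>" "gp f Q \<le> c + \<delta>"
    and P: "len f \<le> gp P (inv f \<otimes> P)" and Q: "len f \<le> gp Q (inv f \<otimes> Q)"
  shows "len f \<le> 2 * c + 4 * \<delta>"
proof -
  let ?t = "len f - c - \<delta>"
  have c: "0 \<le> c + \<delta>" using gp_nonneg[of f P] assms by simp
  have "?t \<le> gp (inv f \<otimes> P) (inv f)"
    using car assms(5) gp_shift[of P "inv f"] gp_commute[of f P] by (simp add: len_inv)
  moreover have "?t \<le> gp (inv f) (inv f \<otimes> Q)"
    using car assms(6) gp_shift[of Q "inv f"] gp_commute[of f Q] gp_commute[of "inv f" "inv f \<otimes> Q"]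
    by (simp add: len_inv)
  ultimately have "?t - \<delta> \<le> gp (inv f \<otimes> P) (inv f \<otimes> Q)"
    using car by (intro gp_triangle[of "inv f \<otimes> P" "inv f" "inv f \<otimes> Q" ?t]) auto
  then have "?t - \<delta> - \<delta> \<le> gp P (inv f \<otimes> Q)"
    using car P c delta_nonneg by (intro gp_triangle[of P "inv f \<otimes> P" "inv f \<otimes> Q" "?t - \<delta>"]) auto
  then have "?t - \<delta> - \<delta> - \<delta> \<le> gp P Q"
    using car Q c delta_nonneg gp_commute[of Q "inv f \<otimes> Q"] by (intro gp_triangle[of P "inv f \<otimes> Q" Q "?t - \<delta> - \<delta>"]) auto
  then show ?thesis using assms(4) by simp
qed

text \<open>\<open>len (inv P \<otimes> f \<otimes> P)\<close> is the distance by which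
  \<open>f\<close> displaces \<open>P\<close>; it stays bounded if \<open>P\<close> runs through
  powers commuting with \<open>f\<close>.\<close>

lemma gp_left_translate_ge:
  assumes "f \<in> carrier G" "P \<in> carrier G"
  shows "real (len P) - (real (len f) + len (inv P \<otimes> f \<otimes> P)) / 2 \<le> gp P (inv f \<otimes> P)"
proof -
  have "inv (inv P \<otimes> f \<otimes> P) = inv P \<otimes> (inv f \<otimes> P)" using assms by (simp add: inv_mult_group m_assoc)
  then have "len (inv P \<otimes> (inv f \<otimes> P)) = len (inv P \<otimes> f \<otimes> P)"
    using len_inv[of "inv P \<otimes> f \<otimes> P"] assms by simp
  moreover have "len P \<le> len f + len (inv f \<otimes> P)" using len_mult[of f "inv f \<otimes> P"] assms by simp
  ultimately show ?thesis by (simp add: gromov_def field_simps)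
qed

lemma finite_class_short:
  assumes ax: "axial b c" and y: "y \<in> carrier G"
    and sep: "\<And>(i::int) (j::int). gp (b [^] i) (y \<otimes> b [^] j) \<le> c"
    and f: "f \<in> carrier G" "finite (conj_class G f)"
  shows "len f \<le> 2 * c + 4 * \<delta>"
proof -
  note b = axial_carrier[OF ax]
  obtain k :: int where k: "k \<noteq> 0" "f \<otimes> b [^] k = b [^] k \<otimes> f"
    using commute_pow_if_finite_class[OF f b] by blast
  obtain l :: int where l: "l \<noteq> 0" "f \<otimes> (y \<otimes> b \<otimes> inv y) [^] l = (y \<otimes> b \<otimes> inv y) [^] l \<otimes> f"
    using commute_pow_if_finite_class[OF f, of "y \<otimes> b \<otimes> inv y"] b y by auto
  define f' where "f' = inv y \<otimes> f \<otimes> y"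
  have f': "f' \<in> carrier G" using f y by (simp add: f'_def)
  have "f' \<otimes> b [^] l = inv y \<otimes> (f \<otimes> (y \<otimes> b \<otimes> inv y) [^] l) \<otimes> y"
    unfolding conj_int_pow[OF b y] f'_def using f y b by (simp add: m_assoc)
  also have "\<dots> = b [^] l \<otimes> f'"
    unfolding l(2) unfolding conj_int_pow[OF b y] f'_def using f y b by (simp add: m_assoc)
  finally have l': "f' \<otimes> b [^] l = b [^] l \<otimes> f'" .
  have lenf': "len f' \<le> len f + 2 * len y"
    unfolding f'_def using len_mult[of "inv y \<otimes> f" y] len_mult[of "inv y" f] y f by (simp add: len_inv)
  \<comment> \<open>At \<open>?P\<close> and \<open>?Q\<close> the displacement is
    \<open>len f\<close>. At \<open>?Y\<close> it is at most \<open>len f + 2 * len y\<close>, and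
    \<open>?Y\<close> may be shorter than \<open>b [^] (l * n)\<close> by \<open>len y\<close>. This
    \<open>n\<close> leaves a product of at least \<open>len f\<close> in all cases.\<close>
  define n where "n = 2 * int (len f) + 2 * int (len y)"
  have far: "n \<le> len (b [^] (m * n')) " if "m \<noteq> 0" "n' = n \<or> n' = - n" for m n' :: int
  proof -
    have "n * 1 \<le> n * \<bar>m\<bar>" using that by (intro mult_left_mono) (auto simp: n_def)
    also have "\<dots> = \<bar>m * n'\<bar>" using that by (auto simp: abs_mult n_def)
    finally show ?thesis using axial_len[OF ax, of "m * n'"] by simp
  qed
  have X: "len f \<le> gp (b [^] (k * n')) (inv f \<otimes> b [^] (k * n'))" if "n' = n \<or> n' = - n" for n'
  proof -
    have "inv (b [^] (k * n')) \<otimes> f \<otimes> b [^] (k * n') = f"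
      using commensurating_pow[OF b f(1) k(2), of n'] f b by (simp add: m_assoc)
    then show ?thesis
      using gp_left_translate_ge[OF f(1), of "b [^] (k * n')"] far[OF k(1) that] b by (simp add: n_def)
  qed
  let ?P = "b [^] (k * n)" and ?Q = "b [^] (k * (- n))" and ?Y = "y \<otimes> b [^] (l * n)"
  have Y: "len f \<le> gp ?Y (inv f \<otimes> ?Y)"
  proof -
    have "inv ?Y \<otimes> f \<otimes> ?Y = inv (b [^] (l * n)) \<otimes> (f' \<otimes> b [^] (l * n))"
      using f y b by (simp add: m_assoc inv_mult_group f'_def)
    also have "\<dots> = f'" unfolding commensurating_pow[OF b f' l'] using f' b by simp
    finally have *: "inv ?Y \<otimes> f \<otimes> ?Y = f'" .
    have "real (len (b [^] (l * n))) \<le> real (len y) + real (len ?Y)"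
      using len_mult_real[of "inv y" ?Y] y b by (simp add: len_inv)
    moreover have "real_of_int n \<le> len (b [^] (l * n))" using far[OF l(1), of n] by linarith
    moreover have "real (len ?Y) - (real (len f) + len f') / 2 \<le> gp ?Y (inv f \<otimes> ?Y)"
      using gp_left_translate_ge[OF f(1), of ?Y] b y unfolding * by simp
    moreover have "real (len f') \<le> real (len f) + 2 * real (len y)" using lenf' by linarith
    moreover have "real_of_int n = 2 * real (len f) + 2 * real (len y)" by (simp add: n_def)
    ultimately show ?thesis by (simp add: field_simps)
  qed
  have PQ: "gp ?P ?Q \<le> c"
  proof (cases "k * n \<ge> 0")
    case True then show ?thesis by (intro axial_opposite[OF ax]) auto
  next
    case False
    then have "gp ?Q ?P \<le> c" by (intro axial_opposite[OF ax]) auto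
    then show ?thesis using gp_commute b by simp
  qed
  \<comment> \<open>Of three pairwise separated points \<open>f\<close> can follow at most one; the
    other two are the pair for \<open>len_le_if_median\<close>.\<close>
  have two: "gp f U \<le> c + \<delta> \<or> gp f V \<le> c + \<delta>" if "U \<in> carrier G" "V \<in> carrier G" "gp U V \<le> c" for U V
    using four_point[of U f V] gp_commute[of U f] that f by linarith
  note 1 = two[OF _ _ PQ] and 2 = two[OF _ _ sep[of "k * n" "l * n"]] and 3 = two[OF _ _ sep[of "k * (- n)" "l * n"]]
  have c: "?P \<in> carrier G" "?Q \<in> carrier G" "?Y \<in> carrier G" using b y by auto
  from 1 2 3 c consider "gp f ?P \<le> c + \<delta>" "gp f ?Q \<le> c + \<delta>" | "gp f ?P \<le> c + \<delta>" "gp f ?Y \<le> c + \<delta>"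
    | "gp f ?Q \<le> c + \<delta>" "gp f ?Y \<le> c + \<delta>" by blast
  then show ?thesis
  proof cases
    case 1 show ?thesis by (rule len_le_if_median[OF f(1) c(1,2) PQ 1]) (rule X, simp)+
  next
    case 2 show ?thesis by (rule len_le_if_median[OF f(1) c(1,3) sep 2]) (rule X Y, simp?)+
  next
    case 3 show ?thesis by (rule len_le_if_median[OF f(1) c(2,3) sep 3]) (rule X Y, simp?)+
  qed
qed

text \<open>A finite group is not \<open>elementary\<close>, so the case without any axis occurs;
  the claim is trivial there.\<close>

lemma finite_finite_classes:
  assumes "\<not> elementary G"
  shows "finite {f \<in> carrier G. finite (conj_class G f)}"
proof (cases "finite (carrier G)")
  case False
  obtain b c y where *: "axial b c" "y \<in> carrier G" "\<And>(i::int) (j::int). gp (b [^] i) (y \<otimes> b [^] j) \<le> c"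
    using exists_separated_axes[OF False assms] by blast
  show ?thesis
  proof (rule finite_subset[OF _ finite_ball])
    show "{f \<in> carrier G. finite (conj_class G f)} \<subseteq> {f \<in> carrier G. len f \<le> nat \<lfloor>2 * c + 4 * \<delta>\<rfloor>}"
      using finite_class_short[OF *] by (auto simp: le_nat_floor)
  qed
qed simp

section \<open>Conjugates with separated directions\<close>

text \<open>The conjugate and its inverse \<open>x \<otimes> inv g \<otimes> inv x\<close> both
  start along \<open>x\<close>, for half their length up to \<open>len g / 2\<close>.\<close>

lemma conj_gp_inv:
  assumes "x \<in> carrier G" "g \<in> carrier G"
  shows "(real (len (x \<otimes> g \<otimes> inv x)) - len g) / 2 - \<delta> \<le> gp (x \<otimes> g \<otimes> inv x) (inv (x \<otimes> g \<otimes> inv x))"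
proof -
  let ?v = "x \<otimes> g \<otimes> inv x"
  have e: "inv ?v = x \<otimes> inv g \<otimes> inv x" using assms by (simp add: inv_mult_group m_assoc)
  have aux: "(real (len (x \<otimes> h \<otimes> inv x)) - len h) / 2 \<le> gp x (x \<otimes> h \<otimes> inv x)" if "h \<in> carrier G" for h
    using assms that len_mult[of h "inv x"] by (simp add: gromov_def m_assoc len_inv)
  have "(real (len ?v) - len g) / 2 \<le> gp ?v x" using aux[of g] gp_commute assms by simp
  moreover have "(real (len ?v) - len g) / 2 \<le> gp x (inv ?v)"
    using aux[of "inv g"] assms len_inv[of ?v] by (simp add: e len_inv)
  ultimately show ?thesis using assms by (intro gp_triangle[of _ x]) auto
qed

text \<open>As \<open>v\<close> avoids the axis, \<open>d [^] m \<otimes> v\<close> follows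
  \<open>d [^] m\<close> beyond \<open>c + \<delta>\<close>, whereas \<open>v\<close> leaves it at
  \<open>c\<close>.\<close>

lemma gp_translate_axis:
  assumes "v \<in> carrier G" "d \<in> carrier G" and gp: "\<And>i::int. gp v (d [^] i) \<le> c"
    and "2 * c + \<delta> < len (d [^] (m::int))"
  shows "gp v (d [^] m \<otimes> v) \<le> c + \<delta>"
proof -
  have "gp (d [^] m \<otimes> v) (d [^] m) = len (d [^] m) - gp v (d [^] (- m))"
    using assms by (simp add: gp_shift int_pow_neg)
  then have "gp (d [^] m \<otimes> v) (d [^] m) > c + \<delta>" using gp[of "- m"] assms(4) by linarith
  then show ?thesis
    using gp_cases[of v "d [^] m \<otimes> v" "d [^] m"] gp[of m] assms(1,2) by auto
qed

text \<open>The conjugates are \<open>d\<^sup>M\<^sup>i v d\<^sup>-\<^sup>M\<^sup>i\<close> with \<open>v\<close> very long.  Both \<open>v\<close> and \<open>v\<^sup>-\<^sup>1\<close> point in the same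
  direction up to about half their length, and \<open>d\<close> is a loxodromic element whose axis avoids
  this direction; one of two elements with separated axes has this property.\<close>

lemma separated_conjugates:
  assumes "\<not> elementary G" and g: "g \<in> carrier G" "infinite (conj_class G g)"
  obtains u :: "nat \<Rightarrow> 'a" where "\<And>i. u i \<in> conj_class G g"
    "\<And>i j. i < n \<Longrightarrow> j < n \<Longrightarrow> i \<noteq> j \<Longrightarrow> gp (u i) (u j) + \<delta> < min (len (u i)) (len (u j)) / 2"
    "\<And>i j. i < n \<Longrightarrow> j < n \<Longrightarrow> i \<noteq> j \<Longrightarrow> gp (inv (u i)) (inv (u j)) + \<delta> < min (len (u i)) (len (u j)) / 2"
proof -
  have Kc: "conj_class G g \<subseteq> carrier G" using g by (auto simp: conj_class_def)
  then have "infinite (carrier G)" using g(2) finite_subset by blast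
  then obtain b c y where ax: "axial b c" and y: "y \<in> carrier G"
    and sep: "\<And>(i::int) (j::int). gp (b [^] i) (y \<otimes> b [^] j) \<le> c"
    using exists_separated_axes assms(1) by blast
  note b = axial_carrier[OF ax] and d0 = delta_nonneg and c0 = axial_nonneg[OF ax]
  \<comment> \<open>\<open>c2 - \<delta>\<close> bounds how far \<open>v\<close> follows either
    possible axis, \<open>len y\<close> being the cost of conjugating the axis by \<open>y\<close>;
    the last \<delta> is spent on passing to \<open>inv v\<close>.\<close>
  define c2 where "c2 = c + 2 * \<delta> + len y"
  \<comment> \<open>\<open>d [^] i\<close> has length at least
    \<open>\<bar>i\<bar> - 2 * len y\<close>, so nonzero multiples of \<open>M\<close> give powers
    longer than \<open>2 * c2 + \<delta>\<close>.\<close>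
  define M where "M = nat \<lceil>2 * c2 + \<delta> + 2 * len y + 1\<rceil>"
  have M: "2 * c2 + \<delta> + 2 * len y < M" unfolding M_def by linarith
  \<comment> \<open>Bounds the lengths of the conjugating elements. It depends on \<open>n\<close>
    but not on \<open>v\<close>, which can therefore be chosen long compared with it.\<close>
  define D where "D = M * n * (len b + 2 * len y)"
  \<comment> \<open>Conjugation shortens \<open>v\<close> by at most \<open>2 * D\<close>, and the
    products to be beaten by half of the length contain \<open>3 * D\<close>, whence
    \<open>8 * D\<close>. The summand \<open>len g\<close> makes \<open>v\<close> and
    \<open>inv v\<close> share more than \<open>c2\<close>.\<close>
  obtain v where v: "v \<in> conj_class G g" "len v > nat \<lceil>2 * c2 + 4 * \<delta> + 8 * D + len g\<rceil>"
    using exists_long[OF Kc g(2)] by blast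
  then have vlen: "len v > 2 * c2 + 4 * \<delta> + 8 * D + len g" by linarith
  have vc: "v \<in> carrier G" using v Kc by blast
  obtain d where d: "d \<in> carrier G" "\<And>i::int. gp v (d [^] i) \<le> c2 - \<delta>" "len d \<le> len b + 2 * len y"
    "\<And>i::int. \<bar>i\<bar> \<le> len (d [^] i) + 2 * int (len y)"
  proof (cases "\<forall>i::int. gp v (b [^] i) \<le> c + \<delta>")
    case True
    have "\<bar>i\<bar> \<le> len (b [^] i) + 2 * int (len y)" for i :: int using axial_len[OF ax, of i] by linarith
    moreover have "gp v (b [^] i) \<le> c2 - \<delta>" for i :: int
      using True[rule_format, of i] by (simp add: c2_def)
    ultimately show ?thesis using that[of b] b by simp
  next
    case False
    then obtain i :: int where i: "gp v (b [^] i) > c + \<delta>" by (auto simp: not_le)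
    \<comment> \<open>As \<open>v\<close> follows the first axis, it cannot follow the second
      one.\<close>
    have vy: "gp v (y \<otimes> b [^] j) \<le> c + \<delta>" for j :: int
      using gp_cases[of "b [^] i" v "y \<otimes> b [^] j"] sep[of i j] i gp_commute[of v "b [^] i"] vc b y by auto
    let ?d = "y \<otimes> b \<otimes> inv y"
    note p = conj_int_pow[OF b y]
    have "gp v (?d [^] j) \<le> c2 - \<delta>" for j :: int
    proof -
      have "gp (y \<otimes> b [^] j \<otimes> inv y) v \<le> gp (y \<otimes> b [^] j) v + len y"
        using gp_mult_right_le[of "y \<otimes> b [^] j" v "inv y"] vc b y by (simp add: len_inv)
      then show ?thesis unfolding p using vy[of j] vc b y gp_commute by (simp add: c2_def)
    qed
    moreover have "len ?d \<le> len b + 2 * len y"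
      using len_mult[of "y \<otimes> b" "inv y"] len_mult[of y b] b y by (simp add: len_inv)
    moreover have "\<bar>j\<bar> \<le> len (?d [^] j) + 2 * int (len y)" for j :: int
    proof -
      have "b [^] j = inv y \<otimes> (?d [^] j) \<otimes> y" unfolding p using b y by (simp add: m_assoc)
      then have "len (b [^] j) \<le> len y + len (?d [^] j) + len y"
        using len_mult[of "inv y \<otimes> (?d [^] j)" y] len_mult[of "inv y" "?d [^] j"] b y by (simp add: len_inv)
      then show ?thesis using axial_len[OF ax, of j] by linarith
    qed
    ultimately show ?thesis using that[of ?d] b y by simp
  qed
  define a where "a i = d [^] (int M * int i)" for i :: nat
  have ac [simp]: "a i \<in> carrier G" for i using d by (simp add: a_def)
  have alen: "len (a i) \<le> D" if "i < n" for i
  proof -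
    have "len (a i) \<le> M * i * len d" unfolding a_def using len_int_pow_le[OF d(1), of "int M * int i"]
      by (simp add: nat_mult_distrib abs_mult)
    also have "\<dots> \<le> M * n * (len b + 2 * len y)" using that d(3) by (intro mult_mono) auto
    finally show ?thesis by (simp add: D_def)
  qed
  \<comment> \<open>\<open>v\<close> and \<open>inv v\<close> share more than \<open>c2\<close>, so
    \<open>inv v\<close> cannot follow \<open>d\<close> further than \<open>v\<close> does, up to
    \<delta>.\<close>
  have gpinv: "gp (inv v) (d [^] i) \<le> c2" for i :: int
  proof (rule ccontr)
    assume "\<not> ?thesis"
    moreover obtain x where x: "x \<in> carrier G" "v = x \<otimes> g \<otimes> inv x" using v by (auto simp: conj_class_def)
    have "gp v (inv v) > c2" using conj_gp_inv[OF x(1) g(1)] vlen d0 unfolding x(2)[symmetric]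
      by (simp add: field_simps)
    ultimately show False using gp_cases[of v "inv v" "d [^] i"] d(2)[of i] d(1) vc by auto
  qed
  \<comment> \<open>Translation by \<open>a i\<close> costs \<open>len (a i)\<close>, and the
    trailing factors cost \<open>len (a i)\<close> and \<open>len (a j)\<close>, together at most
    \<open>3 * D\<close>. The element \<open>w\<close> will be \<open>v\<close> or
    \<open>inv v\<close>.\<close>
  have key: "gp (a i \<otimes> w \<otimes> inv (a i)) (a j \<otimes> w \<otimes> inv (a j)) \<le> c2 + \<delta> + 3 * D"
    if w: "w \<in> carrier G" "\<And>m::int. gp w (d [^] m) \<le> c2" and ij: "i < n" "j < n" "i \<noteq> j" for w i j
  proof -
    let ?m = "int M * (int j - int i)"
    have "int M * 1 \<le> int M * \<bar>int j - int i\<bar>" using ij by (intro mult_left_mono) auto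
    then have "int M \<le> \<bar>?m\<bar>" by (simp add: abs_mult)
    then have "int M \<le> len (d [^] ?m) + 2 * int (len y)" using d(4)[of ?m] by linarith
    then have "2 * c2 + \<delta> < len (d [^] ?m)" using M by linarith
    then have "gp w (d [^] ?m \<otimes> w) \<le> c2 + \<delta>" by (intro gp_translate_axis w d)
    moreover have "a i \<otimes> (d [^] ?m \<otimes> w) = a j \<otimes> w"
    proof -
      have "a i \<otimes> d [^] ?m = a j" unfolding a_def using d(1) by (simp add: algebra_simps flip: int_pow_mult)
      then show ?thesis using d w by (simp flip: m_assoc)
    qed
    ultimately have "gp (a i \<otimes> w) (a j \<otimes> w) \<le> c2 + \<delta> + len (a i)"
      using gp_translate_le[of w "d [^] ?m \<otimes> w" "a i"] w d by simp
    moreover have "gp (a i \<otimes> w \<otimes> inv (a i)) (a j \<otimes> w) \<le> gp (a i \<otimes> w) (a j \<otimes> w) + len (a i)"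
      using gp_mult_right_le[of "a i \<otimes> w" "a j \<otimes> w" "inv (a i)"] w by (simp add: len_inv)
    moreover have "gp (a j \<otimes> w \<otimes> inv (a j)) (a i \<otimes> w \<otimes> inv (a i)) \<le> gp (a j \<otimes> w) (a i \<otimes> w \<otimes> inv (a i)) + len (a j)"
      using gp_mult_right_le[of "a j \<otimes> w" "a i \<otimes> w \<otimes> inv (a i)" "inv (a j)"] w by (simp add: len_inv)
    ultimately show ?thesis using alen[OF ij(1)] alen[OF ij(2)] w gp_commute by simp
  qed
  let ?u = "\<lambda>i. a i \<otimes> v \<otimes> inv (a i)"
  have ulen: "len v \<le> len (?u i) + 2 * D" if "i < n" for i
  proof -
    have "v = inv (a i) \<otimes> ?u i \<otimes> a i" using vc by (simp add: m_assoc)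
    then have "len v \<le> len (a i) + len (?u i) + len (a i)"
      using len_mult[of "inv (a i) \<otimes> ?u i" "a i"] len_mult[of "inv (a i)" "?u i"] vc by (simp add: len_inv)
    then show ?thesis using alen[OF that] by simp
  qed
  have bound: "c2 + \<delta> + 3 * D + \<delta> < min (len (?u i)) (len (?u j)) / 2" if "i < n" "j < n" for i j
    using ulen[OF that(1)] ulen[OF that(2)] vlen by (simp add: min_def)
  show ?thesis
  proof (rule that[of ?u])
    fix i
    obtain x where x: "x \<in> carrier G" "v = x \<otimes> g \<otimes> inv x" using v by (auto simp: conj_class_def)
    have "?u i = (a i \<otimes> x) \<otimes> g \<otimes> inv (a i \<otimes> x)" using x g by (simp add: m_assoc inv_mult_group)
    then show "?u i \<in> conj_class G g" using x by (auto simp: conj_class_def)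
  next
    fix i j assume ij: "i < n" "j < n" "i \<noteq> j"
    have "gp v (d [^] m) \<le> c2" for m :: int using d(2)[of m] d0 by simp
    then show "gp (?u i) (?u j) + \<delta> < min (len (?u i)) (len (?u j)) / 2"
      using key[OF vc _ ij] bound[OF ij(1,2)] by force
    have "inv (?u k) = a k \<otimes> inv v \<otimes> inv (a k)" for k using vc by (simp add: inv_mult_group m_assoc)
    then show "gp (inv (?u i)) (inv (?u j)) + \<delta> < min (len (?u i)) (len (?u j)) / 2"
      using key[of "inv v", OF _ gpinv ij] bound[OF ij(1,2)] vc by force
  qed
qed

end

section \<open>Word length and thin triangles\<close>

locale cayley = group G for G :: "('a, 'b) monoid_scheme" (structure) +
  fixes S :: "'a set"
  assumes finite_S: "finite S" and S_carrier: "S \<subseteq> carrier G" and generate_S: "generate G S = carrier G"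
begin

definition letters :: "'a set" where "letters = S \<union> m_inv G ` S"
abbreviation eval_word :: "'a list \<Rightarrow> 'a" where "eval_word ws \<equiv> foldr (\<otimes>) ws \<one>"
abbreviation len :: "'a \<Rightarrow> nat" where "len \<equiv> word_length G S"
abbreviation wd :: "'a \<Rightarrow> 'a \<Rightarrow> nat" where "wd \<equiv> word_dist G S"

lemma letters_carrier: "letters \<subseteq> carrier G" using S_carrier by (auto simp: letters_def)

lemma eval_word_closed [simp]: "set ws \<subseteq> letters \<Longrightarrow> eval_word ws \<in> carrier G"
  using letters_carrier by (induction ws) auto

lemma eval_word_append:
  "set us \<subseteq> letters \<Longrightarrow> set vs \<subseteq> letters \<Longrightarrow> eval_word (us @ vs) = eval_word us \<otimes> eval_word vs"
proof (induction us)
  case (Cons u us)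
  then show ?case using letters_carrier eval_word_closed[of us] eval_word_closed[of vs] by (auto simp: m_assoc)
qed simp

lemma letters_inv: "s \<in> letters \<Longrightarrow> inv s \<in> letters"
  using S_carrier by (auto simp: letters_def)

lemma eval_word_inv:
  "set ws \<subseteq> letters \<Longrightarrow> eval_word (map (m_inv G) (rev ws)) = inv (eval_word ws)"
proof (induction ws)
  case (Cons w ws)
  then have "eval_word (map (m_inv G) (rev ws) @ [inv w]) = inv (eval_word ws) \<otimes> eval_word [inv w]"
    using letters_inv by (subst eval_word_append) auto
  also have "\<dots> = inv (w \<otimes> eval_word ws)"
    using Cons(2) letters_carrier by (auto simp: inv_mult_group)
  finally show ?case by simp
qed simp

lemma exists_word:
  assumes "g \<in> carrier G" shows "\<exists>ws. set ws \<subseteq> letters \<and> eval_word ws = g"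
proof -
  have "g \<in> generate G S" using assms generate_S by simp
  then show ?thesis
  proof induction
    case one then show ?case by (intro exI[of _ "[]"]) simp
  next
    case (incl h) then show ?case using S_carrier by (intro exI[of _ "[h]"]) (auto simp: letters_def)
  next
    case (inv h) then show ?case using S_carrier by (intro exI[of _ "[inv h]"]) (auto simp: letters_def)
  next
    case (eng h1 h2)
    then obtain us vs where "set us \<subseteq> letters" "eval_word us = h1" "set vs \<subseteq> letters" "eval_word vs = h2"
      by blast
    then show ?case using eval_word_append[of us vs] by (intro exI[of _ "us @ vs"]) auto
  qed
qed

lemma minimal_word:
  assumes "g \<in> carrier G"
  obtains ws where "length ws = len g" "set ws \<subseteq> letters" "eval_word ws = g"
proof -
  have "\<exists>n ws. length ws = n \<and> set ws \<subseteq> letters \<and> eval_word ws = g" using exists_word[OF assms] by blast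
  then have "\<exists>ws. length ws = len g \<and> set ws \<subseteq> letters \<and> eval_word ws = g"
    unfolding word_length_def letters_def[symmetric] by (rule LeastI_ex)
  then show ?thesis using that by blast
qed

lemma len_eval_word: "set ws \<subseteq> letters \<Longrightarrow> len (eval_word ws) \<le> length ws"
  unfolding word_length_def letters_def[symmetric] by (rule Least_le) blast

lemma len_one: "len \<one> = 0"
  using len_eval_word[of "[]"] by simp

lemma len_mult: assumes "x \<in> carrier G" "y \<in> carrier G" shows "len (x \<otimes> y) \<le> len x + len y"
proof -
  obtain us where "length us = len x" "set us \<subseteq> letters" "eval_word us = x" using minimal_word assms(1) by blast
  moreover obtain vs where "length vs = len y" "set vs \<subseteq> letters" "eval_word vs = y" using minimal_word assms(2) by blast
  ultimately show ?thesis using len_eval_word[of "us @ vs"] eval_word_append[of us vs] by simp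
qed

lemma len_inv: assumes "x \<in> carrier G" shows "len (inv x) = len x"
proof -
  have le: "len (inv x) \<le> len x" if x: "x \<in> carrier G" for x
  proof -
    obtain us where us: "length us = len x" "set us \<subseteq> letters" "eval_word us = x" using minimal_word x by blast
    have "set (map (m_inv G) (rev us)) \<subseteq> letters" using us(2) letters_inv by auto
    then show ?thesis using len_eval_word[of "map (m_inv G) (rev us)"] eval_word_inv[OF us(2)] us by simp
  qed
  show ?thesis using le[OF assms] le[of "inv x"] assms by simp
qed

lemma finite_ball: "finite {x \<in> carrier G. len x \<le> n}"
proof (rule finite_subset)
  show "{x \<in> carrier G. len x \<le> n} \<subseteq> eval_word ` {ws. set ws \<subseteq> letters \<and> length ws \<le> n}"
  proof safe
    fix x assume "x \<in> carrier G" "len x \<le> n"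
    then show "x \<in> eval_word ` {ws. set ws \<subseteq> letters \<and> length ws \<le> n}"
      using minimal_word[of x] by (metis (mono_tags, lifting) image_eqI mem_Collect_eq)
  qed
  show "finite (eval_word ` {ws. set ws \<subseteq> letters \<and> length ws \<le> n})"
    using finite_S by (intro finite_imageI finite_lists_length_le) (auto simp: letters_def)
qed

lemma len_split:
  assumes "x \<in> carrier G" "k \<le> len x"
  shows "\<exists>y\<in>carrier G. \<exists>z\<in>carrier G. x = y \<otimes> z \<and> len y = k \<and> len z = len x - k"
proof -
  obtain ws where ws: "length ws = len x" "set ws \<subseteq> letters" "eval_word ws = x" using minimal_word assms(1) by blast
  define us vs where "us = take k ws" and "vs = drop k ws"
  have uv: "set us \<subseteq> letters" "set vs \<subseteq> letters"
    using ws(2) set_take_subset[of k ws] set_drop_subset[of k ws] by (auto simp: us_def vs_def)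
  have x: "x = eval_word us \<otimes> eval_word vs"
    using eval_word_append[OF uv] ws(3) by (simp add: us_def vs_def)
  have "len (eval_word us) \<le> k" "len (eval_word vs) \<le> len x - k"
    using len_eval_word[OF uv(1)] len_eval_word[OF uv(2)] ws(1) assms(2) by (auto simp: us_def vs_def)
  moreover have "len x \<le> len (eval_word us) + len (eval_word vs)"
    using len_mult uv x by simp
  ultimately show ?thesis using uv x assms(2)
    by (intro bexI[of _ "eval_word us"] bexI[of _ "eval_word vs"]) auto
qed

lemma wd_self: "x \<in> carrier G \<Longrightarrow> wd x x = 0"
  by (simp add: word_dist_def len_one)

lemma wd_commute: assumes "x \<in> carrier G" "y \<in> carrier G" shows "wd x y = wd y x"
  using len_inv[of "inv x \<otimes> y"] assms by (simp add: word_dist_def inv_mult_group)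

lemma wd_triangle:
  assumes "x \<in> carrier G" "y \<in> carrier G" "z \<in> carrier G" shows "wd x z \<le> wd x y + wd y z"
proof -
  have "inv x \<otimes> z = (inv x \<otimes> y) \<otimes> (inv y \<otimes> z)" using assms by (simp add: m_assoc cancel_left)
  then show ?thesis unfolding word_dist_def using len_mult assms by simp
qed

lemma wd_triangle_real:
  "x \<in> carrier G \<Longrightarrow> y \<in> carrier G \<Longrightarrow> z \<in> carrier G \<Longrightarrow> real (wd x z) \<le> real (wd x y) + real (wd y z)"
  using wd_triangle[of x y z] by linarith

lemma wd_one: "x \<in> carrier G \<Longrightarrow> wd \<one> x = len x"
  by (simp add: word_dist_def)

lemma cell_cases:
  assumes "e \<in> cayley_cells G S"
  obtains a b where "a \<in> carrier G" "b \<in> carrier G" "e = {a, b}" "wd a b \<le> 1"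
proof (cases "\<exists>a\<in>carrier G. e = {a}")
  case True then show ?thesis using that wd_self by force
next
  case False
  then obtain a s where as: "a \<in> carrier G" "s \<in> S" "e = {a, a \<otimes> s}" using assms by (auto simp: cayley_cells_def)
  then have s: "s \<in> carrier G" using S_carrier by blast
  have "inv a \<otimes> (a \<otimes> s) = s" using as s by (simp flip: m_assoc)
  then have "wd a (a \<otimes> s) = len s" by (simp add: word_dist_def)
  also have "\<dots> \<le> 1" using len_eval_word[of "[s]"] as s by (simp add: letters_def)
  finally show ?thesis using as s by (intro that[of a "a \<otimes> s"]) auto
qed

lemma cell_dist:
  assumes "e \<in> cayley_cells G S" "x \<in> e" "y \<in> e" shows "wd x y \<le> 1"
  using cell_cases[OF assms(1)] assms(2,3) wd_commute wd_self
  by (metis insert_iff singletonD zero_le)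

section \<open>Discrete geodesics\<close>

definition vertex_path :: "'a \<Rightarrow> 'a \<Rightarrow> (nat \<Rightarrow> 'a) \<Rightarrow> bool" where
  "vertex_path x y p \<longleftrightarrow> p 0 = x \<and> p (wd x y) = y \<and> (\<forall>i\<le>wd x y. p i \<in> carrier G) \<and>
     (\<forall>i\<le>wd x y. \<forall>j\<le>wd x y. i \<le> j \<longrightarrow> wd (p i) (p j) = j - i) \<and>
     (\<forall>i<wd x y. {p i, p (Suc i)} \<in> cayley_cells G S)"

lemma exists_vertex_path:
  assumes x: "x \<in> carrier G" and y: "y \<in> carrier G"
  shows "\<exists>p. vertex_path x y p"
proof -
  obtain ws where ws: "length ws = wd x y" "set ws \<subseteq> letters" "eval_word ws = inv x \<otimes> y"
    using minimal_word[of "inv x \<otimes> y"] x y by (auto simp: word_dist_def)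
  let ?n = "wd x y"
  define p where "p i = x \<otimes> eval_word (take i ws)" for i
  have tk: "set (take i ws) \<subseteq> letters" "set (drop i ws) \<subseteq> letters" for i
    using ws(2) set_take_subset[of i ws] set_drop_subset[of i ws] by auto
  have pc: "p i \<in> carrier G" for i using tk x by (simp add: p_def)
  have p0: "p 0 = x" using x by (simp add: p_def)
  have pn: "p ?n = y" using ws x y by (simp add: p_def cancel_left)
  have step: "p j = p i \<otimes> eval_word (drop i (take j ws))" "set (drop i (take j ws)) \<subseteq> letters" if "i \<le> j" for i j
  proof -
    show s: "set (drop i (take j ws)) \<subseteq> letters"
      using tk(1)[of j] set_drop_subset[of i "take j ws"] by auto
    have "take j ws = take i ws @ drop i (take j ws)"
      using that by (metis append_take_drop_id min.absorb1 take_take)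
    then show "p j = p i \<otimes> eval_word (drop i (take j ws))"
      unfolding p_def using eval_word_append[OF tk(1)[of i] s] x tk(1)[of i] s by (simp add: m_assoc)
  qed
  have le: "wd (p i) (p j) \<le> j - i" if "i \<le> j" for i j
  proof -
    have "wd (p i) (p j) = len (eval_word (drop i (take j ws)))"
      unfolding word_dist_def step(1)[OF that] using pc step(2)[OF that] by (simp flip: m_assoc)
    also have "\<dots> \<le> j - i" using len_eval_word[OF step(2)[OF that]] by simp
    finally show ?thesis .
  qed
  \<comment> \<open>A shortcut between two vertices would shorten the whole word, which is
    minimal.\<close>
  have "wd (p i) (p j) = j - i" if "i \<le> j" "j \<le> ?n" for i j
  proof -
    have "?n \<le> wd (p 0) (p i) + wd (p i) (p ?n)" using wd_triangle[of x "p i" y] x y pc by (simp add: p0 pn)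
    also have "\<dots> \<le> i + (wd (p i) (p j) + wd (p j) (p ?n))"
      using le[of 0 i] wd_triangle[OF pc pc pc, of i ?n j] by simp
    finally show ?thesis using le[of j ?n] le[of i j] that by simp
  qed
  moreover have "{p i, p (Suc i)} \<in> cayley_cells G S" if i: "i < ?n" for i
  proof -
    have d: "drop i (take (Suc i) ws) = [ws ! i]"
      using i ws(1) by (simp add: take_Suc_conv_app_nth)
    have "ws ! i \<in> letters" using i ws(1,2) nth_mem[of i ws] by auto
    moreover have "p (Suc i) = p i \<otimes> ws ! i"
      using step(1)[of i "Suc i"] d \<open>ws ! i \<in> letters\<close> letters_carrier by auto
    ultimately consider "ws ! i \<in> S" "p (Suc i) = p i \<otimes> ws ! i" | s where "s \<in> S" "p (Suc i) = p i \<otimes> inv s"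
      by (auto simp: letters_def)
    then show ?thesis
    proof cases
      case 1 then show ?thesis using pc by (auto simp: cayley_cells_def)
    next
      case 2
      \<comment> \<open>An inverse letter runs through an edge backwards, so the cell has to be read
        from its other end.\<close>
      then have "p i = p (Suc i) \<otimes> s" using pc S_carrier by (auto simp: m_assoc)
      then have "{p i, p (Suc i)} = {p (Suc i), p (Suc i) \<otimes> s}" by auto
      then show ?thesis using pc[of "Suc i"] 2(1) unfolding cayley_cells_def by blast
    qed
  qed
  ultimately show ?thesis using p0 pn pc unfolding vertex_path_def by blast
qed

text \<open>The realisation of a vertex path has tent functions as its barycentric coordinates.\<close>

definition tent :: "real \<Rightarrow> real" where "tent u = max 0 (1 - \<bar>u\<bar>)"

definition realise :: "(nat \<Rightarrow> 'a) \<Rightarrow> nat \<Rightarrow> real \<Rightarrow> 'a \<Rightarrow> real" where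
  "realise p n t = (\<lambda>a. \<Sum>k\<le>n. if a = p k then tent (t - real k) else 0)"

section \<open>Geodesics in the geometric realisation\<close>

context
  fixes p x y assumes path: "vertex_path x y p"
begin

private abbreviation "n \<equiv> wd x y"
private abbreviation "\<gamma> \<equiv> realise p n"

lemma path_carrier: "i \<le> n \<Longrightarrow> p i \<in> carrier G" using path by (simp add: vertex_path_def)

lemma path_dist: assumes "i \<le> n" "j \<le> n" shows "real (wd (p i) (p j)) = \<bar>real i - real j\<bar>"
proof (cases "i \<le> j")
  case True then show ?thesis using path assms by (simp add: vertex_path_def)
next
  case False
  then have "wd (p j) (p i) = i - j" using path assms by (simp add: vertex_path_def)
  then show ?thesis using False wd_commute[of "p i" "p j"] path_carrier assms by simp
qed

lemma path_inj: "inj_on p {..n}"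
proof (rule inj_onI)
  fix i j assume ij: "i \<in> {..n}" "j \<in> {..n}" "p i = p j"
  then have "real (wd (p i) (p j)) = 0" using wd_self path_carrier by simp
  then show "i = j" using path_dist[of i j] ij by simp
qed

lemma realise_at: assumes "k \<le> n" shows "\<gamma> t (p k) = tent (t - real k)"
proof -
  have "(if p k = p l then tent (t - real l) else 0) = (if l = k then tent (t - real l) else 0)" if "l \<le> n" for l
    using path_inj that assms by (auto simp: inj_on_def)
  then have "\<gamma> t (p k) = (\<Sum>l\<le>n. if l = k then tent (t - real l) else 0)"
    unfolding realise_def by (intro sum.cong) auto
  then show ?thesis using assms by simp
qed

lemma realise_off: "a \<notin> p ` {..n} \<Longrightarrow> \<gamma> t a = 0"
  unfolding realise_def by (intro sum.neutral) auto

lemma realise_support: "support (\<gamma> t) = p ` {k. k \<le> n \<and> \<bar>t - real k\<bar> < 1}"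
proof -
  have "a \<in> support (\<gamma> t) \<longleftrightarrow> a \<in> p ` {k. k \<le> n \<and> \<bar>t - real k\<bar> < 1}" for a
  proof (cases "a \<in> p ` {..n}")
    case True
    then obtain k where k: "k \<le> n" "a = p k" by auto
    have "a \<in> p ` {k. k \<le> n \<and> \<bar>t - real k\<bar> < 1} \<longleftrightarrow> \<bar>t - real k\<bar> < 1"
      using k path_inj by (auto simp: inj_on_def)
    then show ?thesis using k realise_at[of k t] by (auto simp: support_def tent_def)
  next
    case False
    then show ?thesis using realise_off[OF False] by (auto simp: support_def)
  qed
  then show ?thesis by blast
qed

lemma realise_nat: assumes "m \<le> n" shows "\<gamma> (real m) = vertex (p m)"
proof
  fix a
  show "\<gamma> (real m) a = vertex (p m) a"
  proof (cases "a \<in> p ` {..n}")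
    case True
    then obtain k where k: "k \<le> n" "a = p k" by auto
    have "tent (real m - real k) = (if k = m then 1 else 0)" by (auto simp: tent_def)
    then show ?thesis using k realise_at[of k] path_inj assms by (auto simp: vertex_def indicator_def inj_on_def)
  next
    case False
    then show ?thesis using realise_off[OF False] assms by (auto simp: vertex_def indicator_def split: if_splits)
  qed
qed

lemma near_indices:
  assumes "real m \<le> t" "t \<le> real m + 1" "\<bar>t - real k\<bar> < 1" shows "k = m \<or> k = Suc m"
proof -
  have "real k < real (m + 2)" "real m < real (k + 1)" using assms by linarith+
  then have "k < m + 2" "m < k + 1" by linarith+
  then show ?thesis by linarith
qed

text \<open>The case split covers the end of the path: for \<open>m = n\<close> no edge follows, and
  the vertex itself is the cell.\<close>

lemma near_indices_top:
  assumes "m \<le> n" "real m \<le> t" "t \<le> real n" "t \<le> real m + 1" "\<bar>t - real k\<bar> < 1" "k \<le> n"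
  shows "p k \<in> (if m < n then {p m, p (Suc m)} else {p m})"
  using near_indices[of m t k] assms by auto

lemma path_cell: "m \<le> n \<Longrightarrow> (if m < n then {p m, p (Suc m)} else {p m}) \<in> cayley_cells G S"
  using path path_carrier[of m] by (auto simp: vertex_path_def cayley_cells_def)

lemma realise_sum:
  assumes m: "m < n" and f: "\<And>k. k \<le> n \<Longrightarrow> k \<noteq> m \<Longrightarrow> k \<noteq> Suc m \<Longrightarrow> f (p k) = 0"
    and A: "A \<subseteq> p ` {..n}" and off: "\<And>a. a \<in> p ` {..n} - A \<Longrightarrow> f a = (0::real)"
  shows "sum f A = f (p m) + f (p (Suc m))"
proof -
  have "sum f A = sum f (p ` {..n})" by (rule sum.mono_neutral_left) (use A off in auto)
  also have "\<dots> = (\<Sum>k\<le>n. f (p k))" using path_inj by (simp add: sum.reindex)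
  also have "\<dots> = (\<Sum>k\<in>{m, Suc m}. f (p k))" by (rule sum.mono_neutral_right) (use m f in auto)
  finally show ?thesis by simp
qed

lemma tent_far: "1 \<le> \<bar>u\<bar> \<Longrightarrow> tent u = 0" by (simp add: tent_def)
lemma tent_near: "\<bar>u\<bar> \<le> 1 \<Longrightarrow> tent u = 1 - \<bar>u\<bar>" by (simp add: tent_def)

lemma far_index:
  assumes "real m \<le> t" "t \<le> real m + 1" "k \<noteq> m" "k \<noteq> Suc m" shows "1 \<le> \<bar>t - real k\<bar>"
proof (rule ccontr)
  assume "\<not> ?thesis"
  then have "\<bar>t - real k\<bar> < 1" by simp
  from near_indices[OF assms(1,2) this] show False using assms(3,4) by simp
qed

lemma realise_in_graph:
  assumes t: "0 \<le> t" "t \<le> real n" shows "\<gamma> t \<in> cayley_graph G S"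
proof -
  define m where "m = nat \<lfloor>t\<rfloor>"
  have m: "real m \<le> t" "t < real m + 1" "m \<le> n" using t unfolding m_def by linarith+
  have sup: "support (\<gamma> t) \<subseteq> p ` {..n}" unfolding realise_support by auto
  have nn: "0 \<le> \<gamma> t a" for a unfolding realise_def tent_def by (intro sum_nonneg) auto
  show ?thesis
  proof (cases "t = real m")
    case True
    then have e: "\<gamma> t = vertex (p m)" using realise_nat m(3) by simp
    then have "support (\<gamma> t) = {p m}" by (auto simp: support_def vertex_def indicator_def)
    then show ?thesis using nn path_carrier[OF m(3)] e
      by (auto simp: cayley_graph_def cayley_cells_def vertex_def indicator_def)
  next
    case False
    then have mn: "m < n" using m t by linarith
    have "support (\<gamma> t) = {p m, p (Suc m)}"
    proof -
      have "{k. k \<le> n \<and> \<bar>t - real k\<bar> < 1} = {m, Suc m}"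
        using near_indices[of m t] m mn False by auto
      then show ?thesis unfolding realise_support by simp
    qed
    moreover have "(\<Sum>a\<in>support (\<gamma> t). \<gamma> t a) = \<gamma> t (p m) + \<gamma> t (p (Suc m))"
    proof (rule realise_sum[OF mn _ sup])
      show "\<gamma> t (p k) = 0" if "k \<le> n" "k \<noteq> m" "k \<noteq> Suc m" for k
        using realise_at[OF that(1)] tent_far far_index[of m t k] that m by simp
    qed (auto simp: support_def)
    moreover have "\<gamma> t (p m) + \<gamma> t (p (Suc m)) = 1"
      using m mn realise_at[of m t] realise_at[of "Suc m" t] by (simp add: tent_near)
    ultimately show ?thesis using nn path_cell[of m] mn by (simp add: cayley_graph_def)
  qed
qed

lemma realise_dist_le:
  assumes st: "0 \<le> s" "s \<le> t" "t \<le> real n" shows "cayley_dist G S (\<gamma> s) (\<gamma> t) = t - s"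
proof -
  define m where "m = nat \<lfloor>s\<rfloor>"
  have m: "real m \<le> s" "s < real m + 1" "m \<le> n" using st unfolding m_def by linarith+
  let ?A = "support (\<gamma> s) \<union> support (\<gamma> t)"
  show ?thesis
  proof (cases "t \<le> real m + 1")
    case True
    have "support (\<gamma> u) \<subseteq> (if m < n then {p m, p (Suc m)} else {p m})" if u: "s \<le> u" "u \<le> t" for u
    proof -
      have bounds: "real m \<le> u" "u \<le> real n" "u \<le> real m + 1" using m st True u by linarith+
      show ?thesis unfolding realise_support
        by (rule image_subsetI) (use near_indices_top[OF m(3) bounds] in blast)
    qed
    then have "?A \<subseteq> (if m < n then {p m, p (Suc m)} else {p m})" using st(2) by (intro Un_least) blast+
    then have cell: "\<exists>e\<in>cayley_cells G S. ?A \<subseteq> e" using path_cell[OF m(3)] by blast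
    have "(\<Sum>a\<in>?A. \<bar>\<gamma> s a - \<gamma> t a\<bar>) = 2 * (t - s)"
    proof (cases "m < n")
      case False
      then have "s = t" using m st by simp
      then show ?thesis by simp
    next
      case mn: True
      have "(\<Sum>a\<in>?A. \<bar>\<gamma> s a - \<gamma> t a\<bar>) = \<bar>\<gamma> s (p m) - \<gamma> t (p m)\<bar> + \<bar>\<gamma> s (p (Suc m)) - \<gamma> t (p (Suc m))\<bar>"
      proof (rule realise_sum[OF mn])
        show "?A \<subseteq> p ` {..n}" unfolding realise_support by auto
        fix k assume k: "k \<le> n" "k \<noteq> m" "k \<noteq> Suc m"
        show "\<bar>\<gamma> s (p k) - \<gamma> t (p k)\<bar> = 0"
          using realise_at[OF k(1)] tent_far far_index[of m s k] far_index[of m t k] k m st True by simp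
      qed (auto simp: support_def)
      also have "\<dots> = 2 * (t - s)"
        using mn m st True realise_at[of m] realise_at[of "Suc m"] by (simp add: tent_near)
      finally show ?thesis .
    qed
    then show ?thesis using cell by (simp add: cayley_dist_def)
  next
    case False
    \<comment> \<open>The end points through which the shortest path leaves the edge of
      \<open>\<gamma> s\<close> and enters that of \<open>\<gamma> t\<close>; they attain the
      minimum.\<close>
    define k l where "k = nat \<lceil>s\<rceil>" and "l = nat \<lfloor>t\<rfloor>"
    have k: "s \<le> real k" "real k < s + 1" using st unfolding k_def by linarith+
    have l: "real l \<le> t" "t < real l + 1" "l \<le> n" using st unfolding l_def by linarith+
    have "real k < real (m + 2)" using k m by simp
    then have km: "k \<le> m + 1" by linarith
    have "real (m + 1) < real (l + 1)" using False l by simp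
    then have ml: "m + 1 \<le> l" by linarith
    have kl: "k \<le> l" "k \<le> n" using km ml l by simp_all
    have supk: "p k \<in> support (\<gamma> s)" unfolding realise_support using k kl by auto
    have supl: "p l \<in> support (\<gamma> t)" unfolding realise_support using l by auto
    have no: "\<not> (\<exists>e\<in>cayley_cells G S. ?A \<subseteq> e)"
    proof
      assume "\<exists>e\<in>cayley_cells G S. ?A \<subseteq> e"
      then obtain e where e: "e \<in> cayley_cells G S" "?A \<subseteq> e" by blast
      \<comment> \<open>Rounding up gives \<open>l' \<ge> m + 2\<close>, so \<open>p m\<close> and
        \<open>p l'\<close> are too far apart to lie in one cell.\<close>
      define l' where "l' = nat \<lceil>t\<rceil>"
      have l': "t \<le> real l'" "real l' < t + 1" "l' \<le> n" using st unfolding l'_def by linarith+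
      have "p m \<in> ?A" "p l' \<in> ?A" unfolding realise_support using m l' by auto
      then have "wd (p m) (p l') \<le> 1" using cell_dist e by blast
      then have "\<bar>real m - real l'\<bar> \<le> 1" using path_dist[OF m(3) l'(3)] by linarith
      then show False using l' False by linarith
    qed
    let ?M = "{(1 - \<gamma> s a) + real (wd a b) + (1 - \<gamma> t b) | a b. a \<in> support (\<gamma> s) \<and> b \<in> support (\<gamma> t)}"
    have val: "(1 - \<gamma> s (p i)) + real (wd (p i) (p j)) + (1 - \<gamma> t (p j)) = \<bar>s - real i\<bar> + \<bar>real i - real j\<bar> + \<bar>t - real j\<bar>"
      if "i \<le> n" "j \<le> n" "\<bar>s - real i\<bar> < 1" "\<bar>t - real j\<bar> < 1" for i j
      using that realise_at path_dist[OF that(1,2)] by (simp add: tent_near)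
    have "Min ?M = t - s"
    proof (rule Min_eqI)
      have "?M = (\<lambda>(a, b). (1 - \<gamma> s a) + real (wd a b) + (1 - \<gamma> t b)) ` (support (\<gamma> s) \<times> support (\<gamma> t))"
        by auto
      then show "finite ?M" by (simp add: realise_support)
      have "t - s = (1 - \<gamma> s (p k)) + real (wd (p k) (p l)) + (1 - \<gamma> t (p l))"
        using val[of k l] k l kl by simp
      then show "t - s \<in> ?M" using supk supl by blast
    next
      fix z assume "z \<in> ?M"
      then obtain i j where ij: "i \<le> n" "j \<le> n" "\<bar>s - real i\<bar> < 1" "\<bar>t - real j\<bar> < 1"
        "z = (1 - \<gamma> s (p i)) + real (wd (p i) (p j)) + (1 - \<gamma> t (p j))"
        unfolding realise_support by auto
      then have "z = \<bar>s - real i\<bar> + \<bar>real i - real j\<bar> + \<bar>t - real j\<bar>" using val by simp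
      then show "t - s \<le> z" by linarith
    qed
    then show ?thesis unfolding cayley_dist_def if_not_P[OF no] .
  qed
qed

lemma cayley_dist_commute:
  assumes "support q \<subseteq> carrier G" "support r \<subseteq> carrier G"
  shows "cayley_dist G S q r = cayley_dist G S r q"
proof -
  have M: "{(1 - q a) + real (wd a b) + (1 - r b) | a b. a \<in> support q \<and> b \<in> support r} =
    {(1 - r b) + real (wd b a) + (1 - q a) | b a. b \<in> support r \<and> a \<in> support q}"
  proof -
    have "(1 - q a) + real (wd a b) + (1 - r b) = (1 - r b) + real (wd b a) + (1 - q a)"
      if "a \<in> support q" "b \<in> support r" for a b
      using wd_commute[of a b] assms that by (simp add: subset_iff)
    then show ?thesis by (safe; metis)
  qed
  have A: "(\<Sum>a\<in>support r \<union> support q. \<bar>q a - r a\<bar>) = (\<Sum>a\<in>support r \<union> support q. \<bar>r a - q a\<bar>)"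
    by (simp add: abs_minus_commute)
  show ?thesis unfolding cayley_dist_def M Un_commute[of "support q" "support r"] A ..
qed

lemma realise_geodesic: "geodesic_segment G S (vertex x) (vertex y) (\<gamma> ` {0..real n})"
proof -
  have "cayley_dist G S (\<gamma> s) (\<gamma> t) = \<bar>s - t\<bar>" if "s \<in> {0..real n}" "t \<in> {0..real n}" for s t
  proof (cases "s \<le> t")
    case True then show ?thesis using realise_dist_le[of s t] that by simp
  next
    case False
    have "support (\<gamma> s) \<subseteq> carrier G" "support (\<gamma> t) \<subseteq> carrier G"
      unfolding realise_support using path_carrier by auto
    then show ?thesis using False realise_dist_le[of t s] that cayley_dist_commute by simp
  qed
  moreover have "\<gamma> 0 = vertex x" "\<gamma> (real n) = vertex y"
    using realise_nat[of 0] realise_nat[of n] path by (simp_all add: vertex_path_def)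
  moreover have "\<gamma> ` {0..real n} \<subseteq> cayley_graph G S" using realise_in_graph by auto
  ultimately show ?thesis unfolding geodesic_segment_def
    by (intro exI[of _ \<gamma>] exI[of _ "real n"]) auto
qed

text \<open>In a common cell with \<open>a\<close>, all vertices are within 1 of \<open>a\<close>,
  whence the extra 1. Otherwise the shortest path passes through a vertex of the cell of
  \<open>\<gamma> t\<close>, which is then at least as near.\<close>

lemma near_realise:
  assumes a: "a \<in> carrier G" and near: "cayley_dist G S (vertex a) (\<gamma> t) < \<delta>" and "0 < \<delta>"
    and t: "0 \<le> t" "t \<le> real n"
  shows "\<exists>l\<le>n. real (wd a (p l)) < \<delta> + 1"
proof -
  have sa: "support (vertex a) = {a}" by (auto simp: support_def vertex_def indicator_def)
  define m where "m = nat \<lfloor>t\<rfloor>"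
  have m: "real m \<le> t" "t < real m + 1" "m \<le> n" using t unfolding m_def by linarith+
  have pm: "p m \<in> support (\<gamma> t)" unfolding realise_support using m by auto
  show ?thesis
  proof (cases "\<exists>e\<in>cayley_cells G S. support (vertex a) \<union> support (\<gamma> t) \<subseteq> e")
    case True
    then obtain e where "e \<in> cayley_cells G S" "a \<in> e" "p m \<in> e" using sa pm by auto
    then have "wd a (p m) \<le> 1" using cell_dist by blast
    then show ?thesis using m assms(3) by (intro exI[of _ m]) linarith
  next
    case False
    let ?M = "{(1 - vertex a a') + real (wd a' b) + (1 - \<gamma> t b) | a' b. a' \<in> support (vertex a) \<and> b \<in> support (\<gamma> t)}"
    have "?M = (\<lambda>b. real (wd a b) + (1 - \<gamma> t b)) ` support (\<gamma> t)"
      unfolding sa by (auto simp: vertex_def indicator_def split: if_splits)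
    then have "finite ?M" "?M \<noteq> {}" using pm by (auto simp: realise_support)
    then have "Min ?M \<in> ?M" by (rule Min_in)
    then obtain b where b: "b \<in> support (\<gamma> t)" "Min ?M = real (wd a b) + (1 - \<gamma> t b)"
      unfolding sa by (auto simp: vertex_def indicator_def split: if_splits)
    then obtain l where l: "l \<le> n" "b = p l" unfolding realise_support by auto
    have "\<gamma> t b \<le> 1" unfolding l(2) realise_at[OF l(1)] tent_def by simp
    then have "real (wd a b) \<le> Min ?M" using b by simp
    also have "Min ?M < \<delta>" using near unfolding cayley_dist_def if_not_P[OF False] .
    finally show ?thesis using l by (intro exI[of _ l]) auto
  qed
qed

end

section \<open>From thin triangles to the four-point inequality\<close>

lemma thin_vertex_triangles:
  assumes hyp: "delta_hyperbolic G S \<delta>" "0 < \<delta>"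
    and xyz: "x \<in> carrier G" "y \<in> carrier G" "z \<in> carrier G"
    and pqr: "vertex_path x y p" "vertex_path y z q" "vertex_path z x r" and i: "i \<le> wd x y"
  shows "(\<exists>l\<le>wd y z. real (wd (p i) (q l)) < \<delta> + 1) \<or> (\<exists>l\<le>wd z x. real (wd (p i) (r l)) < \<delta> + 1)"
proof -
  let ?P = "realise p (wd x y) ` {0..real (wd x y)}" and ?Q = "realise q (wd y z) ` {0..real (wd y z)}"
    and ?R = "realise r (wd z x) ` {0..real (wd z x)}"
  have "?P \<subseteq> cayley_nbhd G S \<delta> (?Q \<union> ?R)"
    using hyp(1) xyz realise_geodesic[OF pqr(1)] realise_geodesic[OF pqr(2)] realise_geodesic[OF pqr(3)]
    unfolding delta_hyperbolic_def by blast
  moreover have "vertex (p i) \<in> ?P"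
    using realise_nat[OF pqr(1) i] i by (intro image_eqI[of _ _ "real i"]) auto
  ultimately obtain w where w: "w \<in> ?Q \<union> ?R" "cayley_dist G S (vertex (p i)) w < \<delta>"
    unfolding cayley_nbhd_def by blast
  have pi: "p i \<in> carrier G" using path_carrier[OF pqr(1) i] .
  from w(1) show ?thesis
  proof
    assume "w \<in> ?Q"
    then obtain t where "w = realise q (wd y z) t" "0 \<le> t" "t \<le> real (wd y z)" by auto
    then show ?thesis using near_realise[OF pqr(2) pi _ hyp(2), of t] w(2) by blast
  next
    assume "w \<in> ?R"
    then obtain t where "w = realise r (wd z x) t" "0 \<le> t" "t \<le> real (wd z x)" by auto
    then show ?thesis using near_realise[OF pqr(3) pi _ hyp(2), of t] w(2) by blast
  qed
qed

lemma gromov_wd: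
  "x \<in> carrier G \<Longrightarrow> y \<in> carrier G \<Longrightarrow> gromov G len x y = (real (wd \<one> x) + real (wd \<one> y) - real (wd x y)) / 2"
  by (simp add: gromov_def wd_one) (simp add: word_dist_def)

text \<open>Add the triangle inequalities through \<open>p i\<close>, whose distances to
  \<open>x\<close> and \<open>y\<close> sum to \<open>wd x y\<close>. Together with the converse
  estimate below, the product is the distance from \<open>\<one>\<close> to the side, up to a
  constant.\<close>

lemma gromov_le_path:
  assumes "x \<in> carrier G" "y \<in> carrier G" "vertex_path x y p" "i \<le> wd x y"
  shows "gromov G len x y \<le> len (p i)"
proof -
  note pi = path_carrier[OF assms(3,4)]
  have "real (wd (p 0) (p i)) = i" "real (wd (p i) (p (wd x y))) = real (wd x y) - real i"
    using path_dist[OF assms(3), of 0 i] path_dist[OF assms(3), of i "wd x y"] assms(4) by simp_all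
  then have "real (wd x (p i)) = i" "real (wd (p i) y) = real (wd x y) - real i"
    using assms(3) by (auto simp: vertex_path_def)
  moreover have "wd \<one> x \<le> wd \<one> (p i) + wd x (p i)" "wd \<one> y \<le> wd \<one> (p i) + wd (p i) y"
    using wd_triangle[of \<one> "p i" x] wd_triangle[of \<one> "p i" y] wd_commute[of x "p i"] assms(1,2) pi by simp_all
  ultimately have "real (wd \<one> x) + real (wd \<one> y) - real (wd x y) \<le> 2 * real (wd \<one> (p i))" by linarith
  then show ?thesis unfolding gromov_wd[OF assms(1,2)] using wd_one[OF pi] by simp
qed

text \<open>By discrete continuity some vertex of the side from \<open>x\<close> to \<open>y\<close> is close to both other sides
  of the triangle with third vertex \<open>\<one>\<close>.\<close>

lemma path_le_gromov:
  assumes hyp: "delta_hyperbolic G S \<delta>" "0 < \<delta>"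
    and x: "x \<in> carrier G" and y: "y \<in> carrier G" and p: "vertex_path x y p"
  shows "\<exists>i\<le>wd x y. len (p i) \<le> gromov G len x y + (2 * \<delta> + 3)"
proof -
  let ?n = "wd x y"
  obtain q r where q: "vertex_path y \<one> q" and r: "vertex_path \<one> x r"
    using exists_vertex_path x y by (meson one_closed)
  define Q where "Q i = (\<exists>l\<le>wd y \<one>. real (wd (p i) (q l)) < \<delta> + 1)" for i
  define R where "R i = (\<exists>l\<le>wd \<one> x. real (wd (p i) (r l)) < \<delta> + 1)" for i
  have QR: "Q i \<or> R i" if "i \<le> ?n" for i
    unfolding Q_def R_def using thin_vertex_triangles[OF hyp x y one_closed p q r that] .
  have R0: "R 0" unfolding R_def
    by (rule exI[of _ "wd \<one> x"]) (use p r wd_self[OF x] hyp(2) in \<open>simp add: vertex_path_def\<close>)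
  have Qn: "Q ?n" unfolding Q_def
    by (rule exI[of _ 0]) (use p q wd_self[OF y] hyp(2) in \<open>simp add: vertex_path_def\<close>)
  define j where "j = (LEAST j. Q j)"
  have j: "Q j" "j \<le> ?n" unfolding j_def using Qn by (auto intro: LeastI Least_le)
  \<comment> \<open>The predecessor of the first vertex satisfying \<open>Q\<close> satisfies
    \<open>R\<close>. For \<open>j = 0\<close> the truncated subtraction gives \<open>i = 0\<close>,
    where \<open>R0\<close> applies.\<close>
  define i where "i = j - 1"
  have ij: "i \<le> j" "j \<le> i + 1" by (auto simp: i_def)
  have Ri: "R i"
  proof (cases j)
    case 0 then show ?thesis using R0 by (simp add: i_def)
  next
    case (Suc k)
    then have "\<not> Q k" using not_less_Least[of k Q] by (simp add: j_def)
    then show ?thesis using QR[of k] j(2) Suc by (simp add: i_def)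
  qed
  have i: "i \<le> ?n" using j(2) ij by simp
  note pc = path_carrier[OF p i] path_carrier[OF p j(2)]
  obtain l where l: "l \<le> wd \<one> x" "real (wd (p i) (r l)) < \<delta> + 1" using Ri by (auto simp: R_def)
  obtain m where m: "m \<le> wd y \<one>" "real (wd (p j) (q m)) < \<delta> + 1" using j by (auto simp: Q_def)
  note rl = path_carrier[OF r l(1)] and qm = path_carrier[OF q m(1)]
  have on: "wd a (s k) + wd (s k) b = wd a b" if "vertex_path a b s" "k \<le> wd a b" for a b s k
    using path_dist[OF that(1), of 0 k] path_dist[OF that(1), of k "wd a b"] that
    by (auto simp: vertex_path_def)
  have s1: "real (wd \<one> (r l)) + real (wd (r l) x) = real (wd \<one> x)" using on[OF r l(1)] by linarith
  have s2: "real (wd y (q m)) + real (wd (q m) \<one>) = real (wd y \<one>)" using on[OF q m(1)] by linarith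
  have p1: "real (wd x (p i)) = real i" using path_dist[OF p _ i, of 0] p by (simp add: vertex_path_def)
  have p2: "real (wd (p j) y) = real ?n - real j"
    using path_dist[OF p j(2), of ?n] j(2) p by (simp add: vertex_path_def)
  have p3: "real (wd (p i) (p j)) \<le> 1" using path_dist[OF p i j(2)] ij by simp
  have "real (wd \<one> (p i)) \<le> real (wd \<one> (r l)) + real (wd (p i) (r l))"
    "real (wd x (p i)) \<le> real (wd (r l) x) + real (wd (p i) (r l))"
    using wd_triangle_real[of \<one> "r l" "p i"] wd_triangle_real[of x "r l" "p i"]
      wd_commute[OF pc(1) rl] wd_commute[OF x rl] pc rl x by simp_all
  then have X: "real (wd \<one> (p i)) + real i - 2 * (\<delta> + 1) \<le> real (wd \<one> x)"
    using s1 l(2) p1 by argo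
  have "real (wd \<one> (p j)) \<le> real (wd (q m) \<one>) + real (wd (p j) (q m))"
    "real (wd (p j) y) \<le> real (wd y (q m)) + real (wd (p j) (q m))"
    using wd_triangle_real[of \<one> "q m" "p j"] wd_triangle_real[of "p j" "q m" y]
      wd_commute[OF pc(2) qm] wd_commute[OF y qm] wd_commute[OF one_closed qm] pc qm y by simp_all
  then have Y: "real (wd \<one> (p j)) + (real ?n - real j) - 2 * (\<delta> + 1) \<le> real (wd \<one> y)"
    using s2 m(2) p2 unfolding wd_commute[OF one_closed y] by argo
  have "real (wd \<one> (p i)) \<le> real (wd \<one> (p j)) + real (wd (p i) (p j))"
    using wd_triangle_real[of \<one> "p j" "p i"] wd_commute[OF pc] pc by simp
  moreover have "real j \<le> real i + 1" using ij by linarith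
  \<comment> \<open>The two detours cost \<open>4 * (\<delta> + 1)\<close>, and passing between the
    neighbours \<open>p i\<close> and \<open>p j\<close> costs 1 twice.\<close>
  ultimately have "2 * real (wd \<one> (p i)) \<le> real (wd \<one> x) + real (wd \<one> y) - real ?n + 2 * (2 * \<delta> + 3)"
    using X Y p3 by argo
  then have "real (len (p i)) \<le> gromov G len x y + (2 * \<delta> + 3)"
    unfolding gromov_wd[OF x y] wd_one[OF pc(1), symmetric] by (simp add: field_simps)
  then show ?thesis using i by blast
qed

text \<open>With products read as distances from \<open>\<one>\<close> to sides: some vertex of the
  side from \<open>x\<close> to \<open>z\<close> realises its product up to
  \<open>2 * \<delta> + 3\<close>, and it is within \<open>\<delta> + 1\<close> of another
  side.\<close>

lemma hyperbolic_length:
  assumes hyp: "delta_hyperbolic G S \<delta>" "0 < \<delta>"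
  shows "hyperbolic_length G len (3 * \<delta> + 4)"
proof (unfold_locales)
  fix x y z assume x: "x \<in> carrier G" and y: "y \<in> carrier G" and z: "z \<in> carrier G"
  obtain p where p: "vertex_path x z p" using exists_vertex_path x z by blast
  obtain q where q: "vertex_path z y q" using exists_vertex_path y z by blast
  obtain r where r: "vertex_path y x r" using exists_vertex_path x y by blast
  obtain i where i: "i \<le> wd x z" "len (p i) \<le> gromov G len x z + (2 * \<delta> + 3)"
    using path_le_gromov[OF hyp x z p] by blast
  note pi = path_carrier[OF p i(1)]
  have sym: "gromov G len a b = gromov G len b a" if "a \<in> carrier G" "b \<in> carrier G" for a b
    using that by (simp add: gromov_wd wd_commute)
  have close: "real (len v) \<le> len (p i) + (\<delta> + 1)" if "v \<in> carrier G" "real (wd (p i) v) < \<delta> + 1" for v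
    using wd_triangle[OF one_closed pi that(1)] that(2) wd_one[OF pi] wd_one[OF that(1)] by linarith
  from thin_vertex_triangles[OF hyp x z y p q r i(1)]
  show "min (gromov G len x y) (gromov G len y z) - (3 * \<delta> + 4) \<le> gromov G len x z"
  proof
    assume "\<exists>l\<le>wd z y. real (wd (p i) (q l)) < \<delta> + 1"
    then obtain l where l: "l \<le> wd z y" "real (wd (p i) (q l)) < \<delta> + 1" by blast
    then show ?thesis
      using gromov_le_path[OF z y q l(1)] close[OF path_carrier[OF q l(1)] l(2)] i(2) sym[OF z y] by linarith
  next
    assume "\<exists>l\<le>wd y x. real (wd (p i) (r l)) < \<delta> + 1"
    then obtain l where l: "l \<le> wd y x" "real (wd (p i) (r l)) < \<delta> + 1" by blast
    then show ?thesis
      using gromov_le_path[OF y x r l(1)] close[OF path_carrier[OF r l(1)] l(2)] i(2) sym[OF y x] by linarith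
  qed
qed (use len_one len_inv len_mult finite_ball len_split in auto)

end

section \<open>The reduced group algebra\<close>

lemma coord_sum: "coord (sum f I) x = (\<Sum>i\<in>I. coord (f i) x)"
  by (induction I rule: infinite_finite_induct) (simp_all add: zero_ell2.rep_eq plus_ell2.rep_eq)

lemma ell2_eqI: "(\<And>x. coord v x = coord w x) \<Longrightarrow> v = w"
  by (simp add: coord_inject[symmetric] fun_eq_iff)

lemma norm_ell2_square: "(norm v)\<^sup>2 = (\<Sum>\<^sub>\<infinity>x. (cmod (coord v x))\<^sup>2)"
  by (simp add: norm_ell2_def infsum_nonneg)

lemma norm_coord_le: "cmod (coord v x) \<le> norm v"
proof (rule power2_le_imp_le)
  have "(\<Sum>y\<in>{x}. (cmod (coord v y))\<^sup>2) \<le> (\<Sum>\<^sub>\<infinity>y. (cmod (coord v y))\<^sup>2)"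
    by (rule finite_sum_le_infsum) (auto simp: coord_square_summable)
  then show "(cmod (coord v x))\<^sup>2 \<le> (norm v)\<^sup>2" by (simp add: norm_ell2_square)
qed simp

lemma inner_disjoint_support:
  assumes "\<And>x. coord v x = 0 \<or> coord w x = 0" shows "inner v w = 0"
proof -
  have "inner (coord v x) (coord w x) = 0" for x using assms[of x] by auto
  then show ?thesis by (simp add: inner_ell2_def)
qed

lift_definition cutoff :: "'a set \<Rightarrow> 'a ell2 \<Rightarrow> 'a ell2" is "\<lambda>A f x. if x \<in> A then f x else 0"
  subgoal for A f by (rule summable_on_comparison_test[of "\<lambda>x. (cmod (f x))\<^sup>2"]) auto
  done

lemma cutoff_compl: "cutoff A v + cutoff (- A) v = v"
  by (rule ell2_eqI) (simp add: plus_ell2.rep_eq cutoff.rep_eq)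

lemma norm_cutoff_le: "norm (cutoff A v) \<le> norm v"
proof (rule power2_le_imp_le)
  show "(norm (cutoff A v))\<^sup>2 \<le> (norm v)\<^sup>2"
    unfolding norm_ell2_square by (rule infsum_mono[OF coord_square_summable coord_square_summable]) (simp add: cutoff.rep_eq)
qed simp

text \<open>Bessel's inequality: the pieces are orthogonal and add up to a single cutoff of
  \<open>v\<close>.\<close>

lemma sum_norm_cutoff_le:
  assumes "finite I" "disjoint_family_on B I"
  shows "(\<Sum>i\<in>I. (norm (cutoff (B i) v))\<^sup>2) \<le> (norm v)\<^sup>2"
proof -
  have *: "(\<Sum>i\<in>I. (if x \<in> B i then z else 0)) = (if x \<in> (\<Union>i\<in>I. B i) then z else 0)" for x and z :: complex
  proof (cases "x \<in> (\<Union>i\<in>I. B i)")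
    case True
    then obtain i where i: "i \<in> I" "x \<in> B i" by blast
    have "(\<Sum>j\<in>I. (if x \<in> B j then z else 0)) = (\<Sum>j\<in>I. if j = i then z else 0)"
      using i assms(2) by (intro sum.cong) (auto simp: disjoint_family_on_def)
    then show ?thesis using True i assms(1) by simp
  next
    case False then show ?thesis by (auto intro: sum.neutral)
  qed
  have disj: "coord (cutoff (B i) v) x = 0 \<or> coord (cutoff (B j) v) x = 0" if "i \<in> I" "j \<in> I" "i \<noteq> j" for i j x
    using assms(2) that by (auto simp: disjoint_family_on_def cutoff.rep_eq)
  have "(\<Sum>i\<in>I. (norm (cutoff (B i) v))\<^sup>2) = (norm (\<Sum>i\<in>I. cutoff (B i) v))\<^sup>2"
  proof (rule norm_sum_Pythagorean[OF assms(1), symmetric])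
    show "pairwise (\<lambda>i j. orthogonal (cutoff (B i) v) (cutoff (B j) v)) I"
      by (rule pairwiseI, unfold orthogonal_def, rule inner_disjoint_support, rule disj)
  qed
  also have "(\<Sum>i\<in>I. cutoff (B i) v) = cutoff (\<Union>i\<in>I. B i) v"
    by (rule ell2_eqI) (simp only: coord_sum cutoff.rep_eq *)
  also have "(norm \<dots>)\<^sup>2 \<le> (norm v)\<^sup>2" by (intro power_mono norm_cutoff_le) simp
  finally show ?thesis .
qed

section \<open>A ping-pong estimate for sums of translations\<close>

context group
begin

lemma norm_reg_rep_le:
  assumes "g \<in> carrier G" shows "norm (blinfun_apply (reg_rep G g) v) \<le> norm v"
proof -
  have "(\<Sum>\<^sub>\<infinity>h. (cmod (coord (blinfun_apply (reg_rep G g) v) h))\<^sup>2) =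
        (\<Sum>\<^sub>\<infinity>h\<in>carrier G. (cmod (coord v (inv g \<otimes> h)))\<^sup>2)"
    by (rule infsum_cong_neutral) (use assms in \<open>auto simp: coord_reg_rep\<close>)
  then show ?thesis
    using left_translate_square_summable(2)[OF assms, of v] by (simp add: norm_ell2_def)
qed

text \<open>The parts of a vector in the \<open>B i\<close> are small on average as the \<open>B i\<close> are disjoint, and the images
  of the other parts are orthogonal as the \<open>A i\<close> are disjoint.\<close>

lemma norm_sum_reg_rep_le:
  assumes u: "\<And>i. i < n \<Longrightarrow> u i \<in> carrier G"
    and A: "disjoint_family_on A {..<n}" and B: "disjoint_family_on B {..<n}"
    and AB: "\<And>i h. i < n \<Longrightarrow> h \<in> carrier G \<Longrightarrow> h \<notin> B i \<Longrightarrow> u i \<otimes> h \<in> A i"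
  shows "norm (\<Sum>i<n. reg_rep G (u i)) \<le> 2 * sqrt (real n)"
proof (rule norm_blinfun_bound)
  fix v :: "'a ell2"
  let ?R = "\<lambda>i. blinfun_apply (reg_rep G (u i)) (cutoff (B i) v)"
  let ?Q = "\<lambda>i. blinfun_apply (reg_rep G (u i)) (cutoff (- B i) v)"
  have "(norm (\<Sum>i<n. ?R i))\<^sup>2 \<le> (\<Sum>i<n. norm (cutoff (B i) v))\<^sup>2"
    by (intro power_mono order_trans[OF norm_sum] sum_mono norm_reg_rep_le) (use u in auto)
  \<comment> \<open>The Cauchy-Schwarz inequality; the sum of squares is then bounded independently
    of \<open>n\<close>.\<close>
  also have "\<dots> \<le> (\<Sum>i<n. (norm (cutoff (B i) v))\<^sup>2) * card {..<n}"
    by (rule sum_squared_le_sum_of_squares)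
  also have "\<dots> \<le> (norm v)\<^sup>2 * real n"
    using sum_norm_cutoff_le[OF _ B, of v] by (simp add: mult_right_mono)
  also have "\<dots> = (sqrt n * norm v)\<^sup>2" by (simp add: power_mult_distrib)
  finally have R: "norm (\<Sum>i<n. ?R i) \<le> sqrt n * norm v" by (rule power2_le_imp_le) simp
  have supp: "k \<in> A i" if "i < n" "coord (?Q i) k \<noteq> 0" for i k
  proof -
    have k: "k \<in> carrier G" "inv (u i) \<otimes> k \<notin> B i"
      using that coord_reg_rep[OF u[OF that(1)], of "cutoff (- B i) v" k] by (auto simp: cutoff.rep_eq split: if_splits)
    then have "u i \<otimes> (inv (u i) \<otimes> k) \<in> A i" using u that by (intro AB) auto
    then show ?thesis using u[OF that(1)] k by (simp flip: m_assoc)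
  qed
  have "(norm (\<Sum>i<n. ?Q i))\<^sup>2 = (\<Sum>i<n. (norm (?Q i))\<^sup>2)"
  proof (rule norm_sum_Pythagorean)
    show "pairwise (\<lambda>i j. orthogonal (?Q i) (?Q j)) {..<n}"
    proof (rule pairwiseI, unfold orthogonal_def, rule inner_disjoint_support)
      fix i j x assume "i \<in> {..<n}" "j \<in> {..<n}" "i \<noteq> j"
      then show "coord (?Q i) x = 0 \<or> coord (?Q j) x = 0"
        using A supp[of i x] supp[of j x] by (auto simp: disjoint_family_on_def)
    qed
  qed simp
  also have "\<dots> \<le> (\<Sum>i<n. (norm v)\<^sup>2)"
    by (intro sum_mono power_mono order_trans[OF norm_reg_rep_le norm_cutoff_le]) (use u in auto)
  also have "\<dots> = (sqrt n * norm v)\<^sup>2" by (simp add: power_mult_distrib)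
  finally have Q: "norm (\<Sum>i<n. ?Q i) \<le> sqrt n * norm v" by (rule power2_le_imp_le) simp
  have "blinfun_apply (\<Sum>i<n. reg_rep G (u i)) v = (\<Sum>i<n. ?R i + ?Q i)"
    by (simp add: blinfun.sum_left cutoff_compl flip: blinfun.add_right)
  also have "\<dots> = (\<Sum>i<n. ?R i) + (\<Sum>i<n. ?Q i)" by (rule sum.distrib)
  also have "norm \<dots> \<le> sqrt n * norm v + sqrt n * norm v"
    by (rule order_trans[OF norm_triangle_ineq add_mono[OF R Q]])
  finally show "norm (blinfun_apply (\<Sum>i<n. reg_rep G (u i)) v) \<le> 2 * sqrt (real n) * norm v" by (simp add: mult_ac)
qed simp

lemma reg_rep_mult:
  assumes "g \<in> carrier G" "h \<in> carrier G"
  shows "reg_rep G g o\<^sub>L reg_rep G h = reg_rep G (g \<otimes> h)"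
  by (rule blinfun_eqI, rule ell2_eqI) (use assms in \<open>simp add: coord_reg_rep inv_mult_group m_assoc\<close>)

end

section \<open>The reduced algebra is closed under the operations\<close>

lemma op_cscale_linear:
  "op_cscale c (x + y) = op_cscale c x + op_cscale c y"
  "op_cscale (c + d) x = op_cscale c x + op_cscale d x"
  "op_cscale c (op_cscale d x) = op_cscale (c * d) x"
  "op_cscale 0 x = 0" "op_cscale 1 x = x" "op_cscale c 0 = 0" "op_cscale (complex_of_real r) x = r *\<^sub>R x"
  "op_cscale c x o\<^sub>L y = op_cscale c (x o\<^sub>L y)"
  by (rule blinfun_eqI, rule ell2_eqI, simp add: op_cscale_apply cscale.rep_eq plus_ell2.rep_eq zero_ell2.rep_eq
      scaleR_ell2.rep_eq blinfun.add_left blinfun.scaleR_left algebra_simps)+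

lemma op_cscale_sum: "op_cscale c (sum f I) = (\<Sum>i\<in>I. op_cscale c (f i))"
  by (induction I rule: infinite_finite_induct) (simp_all add: op_cscale_linear)

lemma continuous_op_cscale: "continuous_on UNIV (op_cscale c)"
  unfolding op_cscale_def[abs_def] by (intro continuous_intros bounded_bilinear.continuous_on[OF bounded_bilinear_blinfun_compose])

lemma continuous_compose_left: "continuous_on UNIV (\<lambda>x. x o\<^sub>L y)"
  by (intro continuous_intros bounded_bilinear.continuous_on[OF bounded_bilinear_blinfun_compose])

lemma continuous_compose_right: "continuous_on UNIV (\<lambda>y. x o\<^sub>L y)"
  by (intro continuous_intros bounded_bilinear.continuous_on[OF bounded_bilinear_blinfun_compose])

lemma group_algebra_add:
  assumes "x \<in> group_algebra G" "y \<in> group_algebra G" shows "x + y \<in> group_algebra G"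
proof -
  obtain E c where x: "finite E" "E \<subseteq> carrier G" "x = (\<Sum>g\<in>E. op_cscale (c g) (reg_rep G g))"
    using assms by (auto simp: group_algebra_def)
  obtain F d where y: "finite F" "F \<subseteq> carrier G" "y = (\<Sum>g\<in>F. op_cscale (d g) (reg_rep G g))"
    using assms by (auto simp: group_algebra_def)
  let ?c = "\<lambda>g. if g \<in> E then c g else 0" and ?d = "\<lambda>g. if g \<in> F then d g else 0"
  have "x = (\<Sum>g\<in>E \<union> F. op_cscale (?c g) (reg_rep G g))"
    unfolding x by (rule sum.mono_neutral_cong_left) (use x y in \<open>auto simp: op_cscale_linear\<close>)
  moreover have "y = (\<Sum>g\<in>E \<union> F. op_cscale (?d g) (reg_rep G g))"
    unfolding y by (rule sum.mono_neutral_cong_left) (use x y in \<open>auto simp: op_cscale_linear\<close>)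
  ultimately have "x + y = (\<Sum>g\<in>E \<union> F. op_cscale (?c g + ?d g) (reg_rep G g))"
    by (simp add: op_cscale_linear sum.distrib)
  then show ?thesis unfolding group_algebra_def using x y
    by (intro CollectI exI[of _ "E \<union> F"] exI[of _ "\<lambda>g. ?c g + ?d g"]) simp
qed

lemma group_algebra_cscale:
  assumes "x \<in> group_algebra G" shows "op_cscale d x \<in> group_algebra G"
proof -
  obtain E c where x: "finite E" "E \<subseteq> carrier G" "x = (\<Sum>g\<in>E. op_cscale (c g) (reg_rep G g))"
    using assms by (auto simp: group_algebra_def)
  then have "op_cscale d x = (\<Sum>g\<in>E. op_cscale (d * c g) (reg_rep G g))"
    by (simp add: op_cscale_sum op_cscale_linear)
  then show ?thesis unfolding group_algebra_def using x(1,2)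
    by (intro CollectI exI[of _ E] exI[of _ "\<lambda>g. d * c g"]) simp
qed

lemma zero_group_algebra: "0 \<in> group_algebra G"
  unfolding group_algebra_def by (auto intro!: exI[of _ "{}"])

lemma subspace_reduced_cstar: "subspace (reduced_cstar G)"
proof (rule subspaceI)
  show "0 \<in> reduced_cstar G"
    unfolding reduced_cstar_def using zero_group_algebra closure_subset by blast
next
  fix x y assume "x \<in> reduced_cstar G" "y \<in> reduced_cstar G"
  then obtain f g where f: "\<And>n. f n \<in> group_algebra G" "f \<longlonglongrightarrow> x"
    and g: "\<And>n. g n \<in> group_algebra G" "g \<longlonglongrightarrow> y"
    unfolding reduced_cstar_def closure_sequential by blast
  show "x + y \<in> reduced_cstar G"
    unfolding reduced_cstar_def closure_sequential
    using group_algebra_add[OF f(1) g(1)] tendsto_add[OF f(2) g(2)] by (intro exI[of _ "\<lambda>n. f n + g n"]) blast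
next
  fix r x assume "x \<in> reduced_cstar G"
  then obtain f where f: "\<And>n. f n \<in> group_algebra G" "f \<longlonglongrightarrow> x"
    unfolding reduced_cstar_def closure_sequential by blast
  have "r *\<^sub>R f n \<in> group_algebra G" for n
    using group_algebra_cscale[OF f(1), of "complex_of_real r" n] by (simp add: op_cscale_linear)
  then show "r *\<^sub>R x \<in> reduced_cstar G"
    unfolding reduced_cstar_def closure_sequential
    using tendsto_scaleR[OF tendsto_const f(2), of r] by (intro exI[of _ "\<lambda>n. r *\<^sub>R f n"]) blast
qed

lemmas reduced_cstar_add = subspace_add[OF subspace_reduced_cstar]
lemmas reduced_cstar_diff = subspace_diff[OF subspace_reduced_cstar]
lemmas reduced_cstar_0 = subspace_0[OF subspace_reduced_cstar]
lemmas reduced_cstar_sum = subspace_sum[OF subspace_reduced_cstar]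

lemma closed_reduced_cstar: "closed (reduced_cstar G)"
  by (simp add: reduced_cstar_def)

lemma reg_rep_reduced:
  assumes "g \<in> carrier G" shows "reg_rep G g \<in> reduced_cstar G"
proof -
  have "reg_rep G g = (\<Sum>h\<in>{g}. op_cscale 1 (reg_rep G h))" by (simp add: op_cscale_linear)
  then have "reg_rep G g \<in> group_algebra G"
    unfolding group_algebra_def using assms by (intro CollectI exI[of _ "{g}"] exI[of _ "\<lambda>_. 1"]) simp
  then show ?thesis unfolding reduced_cstar_def using closure_subset by blast
qed

text \<open>Closedness absorbs the limits and additivity builds the finite sums, so only multiples
  of single translations remain to be checked.\<close>

lemma reduced_cstar_induct [consumes 1, case_names closed zero add reg]:
  assumes "x \<in> reduced_cstar G" "closed {x. P x}" "P 0" "\<And>x y. P x \<Longrightarrow> P y \<Longrightarrow> P (x + y)"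
    "\<And>c g. g \<in> carrier G \<Longrightarrow> P (op_cscale c (reg_rep G g))"
  shows "P x"
proof -
  have sum: "finite F \<Longrightarrow> F \<subseteq> carrier G \<Longrightarrow> P (\<Sum>g\<in>F. op_cscale (c g) (reg_rep G g))" for F c
    by (induction F rule: finite_induct) (use assms(3-5) in auto)
  have "group_algebra G \<subseteq> {x. P x}"
    unfolding group_algebra_def using sum by auto
  then have "reduced_cstar G \<subseteq> {x. P x}"
    unfolding reduced_cstar_def using assms(2) by (rule closure_minimal)
  then show ?thesis using assms(1) by blast
qed

lemma reduced_cstar_cscale:
  assumes "x \<in> reduced_cstar G" shows "op_cscale c x \<in> reduced_cstar G"
  using assms
proof (induction rule: reduced_cstar_induct)
  case closed
  show ?case using closed_vimage[OF closed_reduced_cstar continuous_op_cscale] by (simp add: vimage_def)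
next
  case (reg d g)
  have "op_cscale d (reg_rep G g) \<in> group_algebra G" for d
    unfolding group_algebra_def using reg by (intro CollectI exI[of _ "{g}"] exI[of _ "\<lambda>_. d"]) simp
  then show ?case unfolding op_cscale_linear reduced_cstar_def using closure_subset by blast
qed (simp_all add: op_cscale_linear reduced_cstar_0 reduced_cstar_add)

context group
begin

lemma reg_rep_compose_cscale:
  "g \<in> carrier G \<Longrightarrow> reg_rep G g o\<^sub>L op_cscale c x = op_cscale c (reg_rep G g o\<^sub>L x)"
  by (rule blinfun_eqI, rule ell2_eqI) (simp add: op_cscale_apply cscale.rep_eq coord_reg_rep)

text \<open>The operator type guarantees only real linearity; complex linearity holds for
  translations and passes to sums and limits.\<close>

lemma reduced_compose_cscale:
  assumes "y \<in> reduced_cstar G" shows "y o\<^sub>L op_cscale c x = op_cscale c (y o\<^sub>L x)"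
  using assms
proof (induction rule: reduced_cstar_induct)
  case closed
  show ?case
    by (intro closed_Collect_eq continuous_compose_left
        continuous_on_compose2[OF continuous_op_cscale continuous_compose_left]) simp
next
  case (reg d g)
  then show ?case by (simp add: op_cscale_linear reg_rep_compose_cscale mult.commute)
qed (simp_all add: op_cscale_linear bounded_bilinear.add_left[OF bounded_bilinear_blinfun_compose])

lemma reduced_cstar_compose:
  assumes x: "x \<in> reduced_cstar G" and y: "y \<in> reduced_cstar G" shows "x o\<^sub>L y \<in> reduced_cstar G"
proof -
  have *: "reg_rep G g o\<^sub>L y \<in> reduced_cstar G" if g: "g \<in> carrier G" for g
    using y
  proof (induction rule: reduced_cstar_induct)
    case closed
    show ?case using closed_vimage[OF closed_reduced_cstar continuous_compose_right] by (simp add: vimage_def)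
  next
    case (reg c h)
    then show ?case
      using g by (simp add: reg_rep_compose_cscale reg_rep_mult reduced_cstar_cscale reg_rep_reduced)
  qed (simp_all add: reduced_cstar_0 reduced_cstar_add bounded_bilinear.add_right[OF bounded_bilinear_blinfun_compose])
  show ?thesis using x
  proof (induction rule: reduced_cstar_induct)
    case closed
    show ?case using closed_vimage[OF closed_reduced_cstar continuous_compose_left] by (simp add: vimage_def)
  next
    case (reg c h)
    then show ?case using * by (simp add: op_cscale_linear reduced_cstar_cscale)
  qed (simp_all add: reduced_cstar_0 reduced_cstar_add bounded_bilinear.add_left[OF bounded_bilinear_blinfun_compose])
qed

end

section \<open>Functionals and traces\<close>

text \<open>Bounded functionals without extensionality, so that the notion also applies to auxiliary
  maps such as \<open>\<lambda>x. \<phi> (y o\<^sub>L x)\<close>.\<close>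

definition functional :: "('a, 'b) monoid_scheme \<Rightarrow> (('a ell2 \<Rightarrow>\<^sub>L 'a ell2) \<Rightarrow> complex) \<Rightarrow> bool" where
  "functional G \<phi> \<longleftrightarrow>
     (\<forall>x\<in>reduced_cstar G. \<forall>y\<in>reduced_cstar G. \<phi> (x + y) = \<phi> x + \<phi> y) \<and>
     (\<forall>c. \<forall>x\<in>reduced_cstar G. \<phi> (op_cscale c x) = c * \<phi> x) \<and>
     (\<exists>K. \<forall>x\<in>reduced_cstar G. cmod (\<phi> x) \<le> K * norm x)"

lemma bounded_functionals_iff:
  "\<phi> \<in> bounded_functionals G \<longleftrightarrow> \<phi> \<in> extensional (reduced_cstar G) \<and> functional G \<phi>"
  by (simp add: bounded_functionals_def functional_def)

lemma functional_bound:
  assumes "functional G \<phi>"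
  obtains K where "0 \<le> K" "\<And>x. x \<in> reduced_cstar G \<Longrightarrow> cmod (\<phi> x) \<le> K * norm x"
proof -
  obtain K where K: "\<And>x. x \<in> reduced_cstar G \<Longrightarrow> cmod (\<phi> x) \<le> K * norm x"
    using assms unfolding functional_def by blast
  have "cmod (\<phi> x) \<le> \<bar>K\<bar> * norm x" if "x \<in> reduced_cstar G" for x
    using K[OF that] by (rule order_trans) (intro mult_right_mono, auto)
  then show ?thesis using that[of "\<bar>K\<bar>"] by simp
qed

lemma functional_0: "functional G \<phi> \<Longrightarrow> \<phi> 0 = 0"
  unfolding functional_def using reduced_cstar_0[of G] by (metis mult_zero_left op_cscale_linear(4))

lemma functional_sum:
  assumes "functional G \<phi>" "\<And>i. i \<in> I \<Longrightarrow> f i \<in> reduced_cstar G"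
  shows "\<phi> (sum f I) = (\<Sum>i\<in>I. \<phi> (f i))"
  using assms(2)
proof (induction I rule: infinite_finite_induct)
  case (insert i I)
  then have "sum f I \<in> reduced_cstar G" "f i \<in> reduced_cstar G" by (auto intro: reduced_cstar_sum)
  then show ?case using insert assms(1) by (simp add: functional_def)
qed (simp_all add: functional_0[OF assms(1)])

lemma functional_lincomb:
  assumes "\<And>i. i \<in> I \<Longrightarrow> functional G (\<phi> i)"
  shows "functional G (\<lambda>x. \<Sum>i\<in>I. c i * \<phi> i x)"
proof -
  have "\<exists>K. \<forall>i\<in>I. \<forall>x\<in>reduced_cstar G. cmod (\<phi> i x) \<le> K i * norm x"
    using assms unfolding functional_def by metis
  then obtain K where K: "\<And>i x. i \<in> I \<Longrightarrow> x \<in> reduced_cstar G \<Longrightarrow> cmod (\<phi> i x) \<le> K i * norm x" by blast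
  have "cmod (\<Sum>i\<in>I. c i * \<phi> i x) \<le> (\<Sum>i\<in>I. cmod (c i) * K i) * norm x" if "x \<in> reduced_cstar G" for x
    unfolding sum_distrib_right
    by (rule order_trans[OF norm_sum sum_mono]) (use K that in \<open>auto simp: norm_mult mult.assoc intro: mult_left_mono\<close>)
  moreover have "(\<Sum>i\<in>I. c i * \<phi> i (x + y)) = (\<Sum>i\<in>I. c i * \<phi> i x) + (\<Sum>i\<in>I. c i * \<phi> i y)"
    if "x \<in> reduced_cstar G" "y \<in> reduced_cstar G" for x y
    unfolding sum.distrib[symmetric] using that assms by (intro sum.cong) (auto simp: functional_def algebra_simps)
  moreover have "(\<Sum>i\<in>I. c i * \<phi> i (op_cscale d x)) = d * (\<Sum>i\<in>I. c i * \<phi> i x)"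
    if "x \<in> reduced_cstar G" for x d
    unfolding sum_distrib_left using that assms by (intro sum.cong) (auto simp: functional_def algebra_simps)
  ultimately show ?thesis unfolding functional_def by blast
qed

lemma functional_restrict:
  "functional G \<phi> \<Longrightarrow> functional G (restrict \<phi> (reduced_cstar G))"
  unfolding functional_def by (simp add: reduced_cstar_add reduced_cstar_cscale)

lemma functional_eqI:
  assumes \<phi>: "functional G \<phi>" and \<psi>: "functional G \<psi>"
    and eq: "\<And>g. g \<in> carrier G \<Longrightarrow> \<phi> (reg_rep G g) = \<psi> (reg_rep G g)"
    and x: "x \<in> reduced_cstar G"
  shows "\<phi> x = \<psi> x"
proof -
  have cont: "continuous_on (reduced_cstar G) \<phi>" if f: "functional G \<phi>" for \<phi>
  proof -
    obtain K where K: "0 \<le> K" "\<And>x. x \<in> reduced_cstar G \<Longrightarrow> cmod (\<phi> x) \<le> K * norm x"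
      using functional_bound[OF f] by blast
    have "K-lipschitz_on (reduced_cstar G) \<phi>"
    proof (rule lipschitz_onI[OF _ K(1)])
      fix x y assume xy: "x \<in> reduced_cstar G" "y \<in> reduced_cstar G"
      have "\<phi> (x - y + y) = \<phi> (x - y) + \<phi> y"
        using f reduced_cstar_diff[OF xy] xy(2) unfolding functional_def by blast
      then have "\<phi> x - \<phi> y = \<phi> (x - y)" by simp
      then show "dist (\<phi> x) (\<phi> y) \<le> K * dist x y"
        using K(2)[OF reduced_cstar_diff[OF xy]] by (simp add: dist_norm)
    qed
    then show ?thesis by (rule lipschitz_on_continuous_on)
  qed
  \<comment> \<open>Membership is carried through the induction because additivity and continuity of
    the functionals are known only on the algebra.\<close>
  have "x \<in> reduced_cstar G \<and> \<phi> x - \<psi> x = 0"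
    using x
  proof (induction rule: reduced_cstar_induct)
    case closed
    show ?case
      by (rule continuous_closed_preimage_constant[OF _ closed_reduced_cstar])
        (intro continuous_intros cont \<phi> \<psi>)
  next
    case zero then show ?case using functional_0[OF \<phi>] functional_0[OF \<psi>] reduced_cstar_0 by simp
  next
    case (add x y) then show ?case using \<phi> \<psi> reduced_cstar_add by (auto simp: functional_def)
  next
    case (reg c g)
    then show ?case using \<phi> \<psi> eq[OF reg] reg_rep_reduced[OF reg] reduced_cstar_cscale
      by (auto simp: functional_def)
  qed
  then show ?thesis by simp
qed

context group
begin

lemma functional_compose_left:
  assumes f: "functional G \<phi>" and y: "y \<in> reduced_cstar G" shows "functional G (\<lambda>x. \<phi> (y o\<^sub>L x))"
proof -
  obtain K where K: "0 \<le> K" "\<And>x. x \<in> reduced_cstar G \<Longrightarrow> cmod (\<phi> x) \<le> K * norm x"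
    using functional_bound[OF f] by blast
  have "cmod (\<phi> (y o\<^sub>L x)) \<le> (K * norm y) * norm x" if "x \<in> reduced_cstar G" for x
    using K(2)[OF reduced_cstar_compose[OF y that]] mult_left_mono[OF norm_blinfun_compose[of y x] K(1)]
    by (simp add: mult.assoc)
  then show ?thesis
    using f reduced_cstar_compose[OF y] unfolding functional_def
    by (auto simp: bounded_bilinear.add_right[OF bounded_bilinear_blinfun_compose] reduced_compose_cscale[OF y])
qed

lemma functional_compose_right:
  assumes f: "functional G \<phi>" and y: "y \<in> reduced_cstar G" shows "functional G (\<lambda>x. \<phi> (x o\<^sub>L y))"
proof -
  obtain K where K: "0 \<le> K" "\<And>x. x \<in> reduced_cstar G \<Longrightarrow> cmod (\<phi> x) \<le> K * norm x"
    using functional_bound[OF f] by blast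
  have "cmod (\<phi> (x o\<^sub>L y)) \<le> (K * norm y) * norm x" if "x \<in> reduced_cstar G" for x
    using K(2)[OF reduced_cstar_compose[OF that y]] mult_left_mono[OF norm_blinfun_compose[of x y] K(1)]
    by (simp add: mult_ac)
  then show ?thesis
    using f reduced_cstar_compose[OF _ y] unfolding functional_def
    by (auto simp: bounded_bilinear.add_left[OF bounded_bilinear_blinfun_compose] op_cscale_linear)
qed

text \<open>Both sides are bounded functionals of each variable separately, so uniqueness extends
  the identity from group elements in one variable at a time.\<close>

lemma functional_trace:
  assumes f: "functional G \<phi>"
    and class_fun: "\<And>g h. g \<in> carrier G \<Longrightarrow> h \<in> carrier G \<Longrightarrow> \<phi> (reg_rep G (g \<otimes> h)) = \<phi> (reg_rep G (h \<otimes> g))"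
    and x: "x \<in> reduced_cstar G" and y: "y \<in> reduced_cstar G"
  shows "\<phi> (x o\<^sub>L y) = \<phi> (y o\<^sub>L x)"
proof -
  have "\<phi> (reg_rep G g o\<^sub>L y) = \<phi> (y o\<^sub>L reg_rep G g)" if g: "g \<in> carrier G" for g
    by (rule functional_eqI[OF functional_compose_left functional_compose_right _ y])
      (use f g in \<open>simp_all add: reg_rep_reduced reg_rep_mult class_fun\<close>)
  then show ?thesis
    using functional_eqI[OF functional_compose_right[OF f y] functional_compose_left[OF f y] _ x] by blast
qed

section \<open>Conjugacy classes and their functionals\<close>

lemma conj_class_self: "g \<in> carrier G \<Longrightarrow> g \<in> conj_class G g"
  unfolding conj_class_def by (auto intro!: exI[of _ \<one>])

lemma conj_class_carrier: "g \<in> carrier G \<Longrightarrow> conj_class G g \<subseteq> carrier G"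
  unfolding conj_class_def by auto

lemma conj_class_trans:
  assumes "g \<in> carrier G" "h \<in> conj_class G g" shows "conj_class G h \<subseteq> conj_class G g"
proof
  fix k assume "k \<in> conj_class G h"
  then obtain x y where xy: "x \<in> carrier G" "h = x \<otimes> g \<otimes> inv x" "y \<in> carrier G" "k = y \<otimes> h \<otimes> inv y"
    using assms by (auto simp: conj_class_def)
  then have "k = (y \<otimes> x) \<otimes> g \<otimes> inv (y \<otimes> x)" using assms(1) by (simp add: m_assoc inv_mult_group)
  then show "k \<in> conj_class G g" using xy unfolding conj_class_def by blast
qed

lemma conj_class_sym:
  assumes "g \<in> carrier G" "h \<in> conj_class G g" shows "g \<in> conj_class G h"
proof -
  obtain x where x: "x \<in> carrier G" "h = x \<otimes> g \<otimes> inv x" using assms by (auto simp: conj_class_def)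
  then have "g = inv x \<otimes> h \<otimes> inv (inv x)" using assms(1) by (simp add: m_assoc) (simp flip: m_assoc)
  then show ?thesis using x unfolding conj_class_def by blast
qed

lemma conj_class_eq:
  assumes "g \<in> carrier G" "h \<in> conj_class G g" shows "conj_class G h = conj_class G g"
  using conj_class_trans[OF assms] conj_class_trans[OF _ conj_class_sym[OF assms]] conj_class_carrier assms by blast

lemma conj_class_mult_commute:
  assumes "g \<in> carrier G" "h \<in> carrier G" shows "h \<otimes> g \<in> conj_class G (g \<otimes> h)"
proof -
  have "h \<otimes> g = h \<otimes> (g \<otimes> h) \<otimes> inv h" using assms by (simp add: m_assoc)
  then show ?thesis using assms unfolding conj_class_def by blast
qed

lemma trace_conj:
  assumes "\<tau> \<in> traces G" "g \<in> carrier G" "h \<in> conj_class G g"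
  shows "\<tau> (reg_rep G h) = \<tau> (reg_rep G g)"
proof -
  obtain x where x: "x \<in> carrier G" "h = x \<otimes> g \<otimes> inv x" using assms by (auto simp: conj_class_def)
  then have "reg_rep G h = reg_rep G (x \<otimes> g) o\<^sub>L reg_rep G (inv x)" using assms(2) by (simp add: reg_rep_mult)
  moreover have "reg_rep G g = reg_rep G (inv x) o\<^sub>L reg_rep G (x \<otimes> g)"
    using assms(2) x by (simp add: reg_rep_mult) (simp flip: m_assoc)
  ultimately show ?thesis using assms x by (simp add: traces_def reg_rep_reduced)
qed

lift_definition delta_one :: "'a ell2" is "\<lambda>x. if x = \<one> then 1 else 0"
  by (rule finite_nonzero_values_imp_summable_on) simp

text \<open>Translation by \<open>h\<close> carries \<open>delta_one\<close> to the indicator of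
  \<open>h\<close>, so the coordinates of \<open>x\<close> applied to \<open>delta_one\<close> are
  the coefficients of \<open>x\<close>. Each is bounded by a multiple of the operator norm, and the
  class is finite.\<close>

lemma exists_class_functional:
  assumes g: "g \<in> carrier G" "finite (conj_class G g)"
  shows "\<exists>\<phi>. is_class_functional G g \<phi>"
proof -
  let ?C = "conj_class G g"
  define \<phi> :: "('a ell2 \<Rightarrow>\<^sub>L 'a ell2) \<Rightarrow> complex" where
    "\<phi> x = (\<Sum>h\<in>?C. coord (blinfun_apply x delta_one) h)" for x
  have "cmod (\<phi> x) \<le> (card ?C * norm (delta_one :: 'a ell2)) * norm x" for x
  proof -
    have "cmod (\<phi> x) \<le> (\<Sum>h\<in>?C. cmod (coord (blinfun_apply x delta_one) h))" unfolding \<phi>_def by (rule norm_sum)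
    also have "\<dots> \<le> (\<Sum>h\<in>?C. norm x * norm (delta_one :: 'a ell2))"
      by (intro sum_mono order_trans[OF norm_coord_le norm_blinfun])
    finally show ?thesis by (simp add: mult_ac)
  qed
  then have "functional G \<phi>"
    unfolding functional_def
    by (auto simp: \<phi>_def blinfun.add_left plus_ell2.rep_eq sum.distrib op_cscale_apply cscale.rep_eq sum_distrib_left)
  moreover have "\<phi> (reg_rep G h) = (if h \<in> ?C then 1 else 0)" if h: "h \<in> carrier G" for h
  proof -
    have "coord (blinfun_apply (reg_rep G h) delta_one) k = (if k = h then 1 else 0)" if "k \<in> ?C" for k
    proof -
      have k: "k \<in> carrier G" using that conj_class_carrier g by blast
      have "inv h \<otimes> k = \<one> \<longleftrightarrow> k = h" using h k inv_equality[of "inv h" k] by (metis inv_equality inv_inv l_inv inv_closed)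
      then show ?thesis using h k by (simp add: coord_reg_rep delta_one.rep_eq)
    qed
    then have "\<phi> (reg_rep G h) = (\<Sum>k\<in>?C. if k = h then 1 else 0)" unfolding \<phi>_def by (intro sum.cong) auto
    then show ?thesis using g by simp
  qed
  ultimately have "is_class_functional G g (restrict \<phi> (reduced_cstar G))"
    by (simp add: is_class_functional_def bounded_functionals_iff functional_restrict reg_rep_reduced)
  then show ?thesis by blast
qed

lemma class_functional_unique:
  assumes "is_class_functional G g \<phi>" "is_class_functional G g \<psi>" shows "\<phi> = \<psi>"
proof (rule extensionalityI)
  show "\<phi> \<in> extensional (reduced_cstar G)" "\<psi> \<in> extensional (reduced_cstar G)"
    using assms by (simp_all add: is_class_functional_def bounded_functionals_iff)
  show "\<phi> x = \<psi> x" if "x \<in> reduced_cstar G" for x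
    by (rule functional_eqI[OF _ _ _ that]) (use assms in \<open>simp_all add: is_class_functional_def bounded_functionals_iff\<close>)
qed

lemma ex1_class_functional:
  "g \<in> carrier G \<Longrightarrow> finite (conj_class G g) \<Longrightarrow> \<exists>!\<phi>. is_class_functional G g \<phi>"
  using exists_class_functional class_functional_unique by blast

lemma is_class_functional_class_functional:
  "g \<in> carrier G \<Longrightarrow> finite (conj_class G g) \<Longrightarrow> is_class_functional G g (class_functional G g)"
  unfolding class_functional_def by (rule theI'[OF ex1_class_functional])

lemma class_functional:
  assumes "g \<in> carrier G" "finite (conj_class G g)"
  shows "functional G (class_functional G g)"
    and "h \<in> carrier G \<Longrightarrow> class_functional G g (reg_rep G h) = (if h \<in> conj_class G g then 1 else 0)"
  using is_class_functional_class_functional[OF assms] by (simp_all add: is_class_functional_def bounded_functionals_iff)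

lemma lincomb_class_functionals_trace:
  assumes "F \<subseteq> {g \<in> carrier G. finite (conj_class G g)}"
  shows "(\<lambda>x\<in>reduced_cstar G. \<Sum>g\<in>F. c g * class_functional G g x) \<in> traces G"
proof -
  let ?\<phi> = "\<lambda>x. \<Sum>g\<in>F. c g * class_functional G g x"
  have f: "functional G ?\<phi>" by (rule functional_lincomb) (use assms class_functional(1) in blast)
  have "?\<phi> (reg_rep G (h \<otimes> k)) = ?\<phi> (reg_rep G (k \<otimes> h))" if hk: "h \<in> carrier G" "k \<in> carrier G" for h k
  proof (rule sum.cong[OF refl])
    fix g assume "g \<in> F"
    then have g: "g \<in> carrier G" "finite (conj_class G g)" using assms by auto
    have "h \<otimes> k \<in> conj_class G g \<longleftrightarrow> k \<otimes> h \<in> conj_class G g"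
      using conj_class_mult_commute hk conj_class_trans[OF g(1)] by blast
    then show "c g * class_functional G g (reg_rep G (h \<otimes> k)) = c g * class_functional G g (reg_rep G (k \<otimes> h))"
      using hk class_functional(2)[OF g] by simp
  qed
  from functional_trace[OF f this] show ?thesis
    using functional_restrict[OF f] by (simp add: traces_def bounded_functionals_iff reduced_cstar_compose)
qed

lemma trace_eq_lincomb:
  assumes fin: "finite {g \<in> carrier G. finite (conj_class G g)}"
    and \<tau>: "\<tau> \<in> traces G"
    and van: "\<And>g. g \<in> carrier G \<Longrightarrow> infinite (conj_class G g) \<Longrightarrow> \<tau> (reg_rep G g) = 0"
  shows "\<exists>F c. \<tau> = (\<lambda>x\<in>reduced_cstar G. \<Sum>g\<in>F. c g * class_functional G g x) \<and>
    finite F \<and> F \<subseteq> {g \<in> carrier G. finite (conj_class G g)}"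
proof -
  let ?Z = "{g \<in> carrier G. finite (conj_class G g)}"
  let ?r = "inv_into ?Z (conj_class G)"
  \<comment> \<open>One representative for each class: all elements of a class have the same
    functional, which must be counted once.\<close>
  define F where "F = ?r ` conj_class G ` ?Z"
  have "?r C \<in> ?Z" if "C \<in> conj_class G ` ?Z" for C by (rule inv_into_into[OF that])
  then have F: "finite F" "F \<subseteq> ?Z" unfolding F_def using fin by blast+
  let ?\<psi> = "\<lambda>x. \<Sum>g\<in>F. \<tau> (reg_rep G g) * class_functional G g x"
  have \<tau>f: "functional G \<tau>" "\<tau> \<in> extensional (reduced_cstar G)" using \<tau> by (simp_all add: traces_def bounded_functionals_iff)
  have \<psi>: "functional G ?\<psi>" by (rule functional_lincomb) (use F class_functional(1) in blast)
  have "\<tau> (reg_rep G h) = ?\<psi> (reg_rep G h)" if h: "h \<in> carrier G" for h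
  proof (cases "finite (conj_class G h)")
    case True
    define g where "g = ?r (conj_class G h)"
    have hZ: "h \<in> ?Z" using h True by simp
    have g: "g \<in> F" "conj_class G g = conj_class G h"
      using hZ f_inv_into_f[of "conj_class G h" "conj_class G" ?Z] by (auto simp: g_def F_def)
    have "h \<in> conj_class G k \<longleftrightarrow> k = g" if "k \<in> F" for k
    proof
      assume hk: "h \<in> conj_class G k"
      obtain l where l: "l \<in> ?Z" "k = ?r (conj_class G l)" using \<open>k \<in> F\<close> by (auto simp: F_def)
      have "conj_class G k = conj_class G l"
        unfolding l(2) by (rule f_inv_into_f) (use l in blast)
      moreover have "conj_class G h = conj_class G k"
        using conj_class_eq[OF _ hk] \<open>k \<in> F\<close> F(2) by blast
      ultimately show "k = g" by (simp add: l(2) g_def)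
    qed (use g conj_class_self[OF h] in simp)
    then have "?\<psi> (reg_rep G h) = (\<Sum>k\<in>F. if k = g then \<tau> (reg_rep G g) else 0)"
      using F h class_functional(2) by (intro sum.cong) (auto simp: subset_iff)
    also have "\<dots> = \<tau> (reg_rep G g)" using F g by simp
    also have "\<dots> = \<tau> (reg_rep G h)"
    proof -
      have "g \<in> carrier G" using g F by blast
      then show ?thesis using trace_conj[OF \<tau> h, of g] conj_class_self[of g] g(2) by simp
    qed
    finally show ?thesis by simp
  next
    case False
    have "h \<notin> conj_class G g" if "g \<in> F" for g
      using conj_class_eq[of g h] F that False by auto
    then have "?\<psi> (reg_rep G h) = 0"
      using F h class_functional(2) by (intro sum.neutral) (auto simp: subset_iff)
    then show ?thesis using van[OF h False] by simp
  qed
  then have "\<tau> x = ?\<psi> x" if "x \<in> reduced_cstar G" for x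
    using functional_eqI[OF \<tau>f(1) \<psi> _ that] by blast
  then have "\<tau> = restrict ?\<psi> (reduced_cstar G)" using \<tau>f(2) by (auto simp: extensional_def fun_eq_iff)
  then show ?thesis using F by (intro exI[of _ F] exI[of _ "\<lambda>g. \<tau> (reg_rep G g)"]) simp
qed

end

section \<open>Vanishing on infinite conjugacy classes\<close>

context hyperbolic_length
begin

lemma trace_vanishes:
  assumes "\<not> elementary G" and \<tau>: "\<tau> \<in> traces G" and g: "g \<in> carrier G" "infinite (conj_class G g)"
  shows "\<tau> (reg_rep G g) = 0"
proof (rule ccontr)
  assume nz: "\<tau> (reg_rep G g) \<noteq> 0"
  have f: "functional G \<tau>" using \<tau> by (simp add: traces_def bounded_functionals_iff)
  obtain K where K: "0 \<le> K" "\<And>x. x \<in> reduced_cstar G \<Longrightarrow> cmod (\<tau> x) \<le> K * norm x"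
    using functional_bound[OF f] by blast
  \<comment> \<open>For this \<open>n\<close>, \<open>n\<close> times the modulus of
    \<open>\<tau> (reg_rep G g)\<close> exceeds \<open>2 * K * sqrt n\<close>.\<close>
  obtain n :: nat where n: "(2 * K / cmod (\<tau> (reg_rep G g)))\<^sup>2 < real n" using reals_Archimedean2 by blast
  obtain u :: "nat \<Rightarrow> 'a" where u: "\<And>i. u i \<in> conj_class G g"
    and sep: "\<And>i j. i < n \<Longrightarrow> j < n \<Longrightarrow> i \<noteq> j \<Longrightarrow> gp (u i) (u j) + \<delta> < min (len (u i)) (len (u j)) / 2"
    and sep': "\<And>i j. i < n \<Longrightarrow> j < n \<Longrightarrow> i \<noteq> j \<Longrightarrow> gp (inv (u i)) (inv (u j)) + \<delta> < min (len (u i)) (len (u j)) / 2"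
    using separated_conjugates[OF assms(1) g] by blast
  have uc: "u i \<in> carrier G" for i using u[of i] conj_class_carrier[OF g(1)] by blast
  define A where "A i = {h \<in> carrier G. len (u i) / 2 \<le> gp h (u i)}" for i
  \<comment> \<open>The inequality is strict here and weak in \<open>A\<close>, so that by
    \<open>gp_shift\<close> the complement of \<open>B i\<close> in the group is mapped into
    \<open>A i\<close> without loss.\<close>
  define B where "B i = {h \<in> carrier G. len (u i) / 2 < gp h (inv (u i))}" for i
  \<comment> \<open>An \<open>h\<close> following both \<open>v\<close> and \<open>w\<close> for
    half of \<open>k\<close> and \<open>l\<close> makes \<open>v\<close> and \<open>w\<close> follow
    each other that far, up to \<delta>; this contradicts the separation.\<close>
  have disj: "gp v w + \<delta> \<ge> min (real k) (real l) / 2"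
    if "v \<in> carrier G" "w \<in> carrier G" "h \<in> carrier G" "k / 2 \<le> gp h v" "l / 2 \<le> gp h w" for v w h and k l :: nat
    using gp_cases[of v h w] gp_commute[of v h] that by (auto simp: min_def)
  have "A i \<inter> A j = {}" if "i < n" "j < n" "i \<noteq> j" for i j
  proof (rule ccontr)
    assume "A i \<inter> A j \<noteq> {}"
    then obtain h where "h \<in> A i" "h \<in> A j" by blast
    then have "min (real (len (u i))) (real (len (u j))) / 2 \<le> gp (u i) (u j) + \<delta>"
      using uc by (intro disj[of _ _ h]) (simp_all add: A_def)
    then show False using sep[OF that] by linarith
  qed
  moreover have "B i \<inter> B j = {}" if "i < n" "j < n" "i \<noteq> j" for i j
  proof (rule ccontr)
    assume "B i \<inter> B j \<noteq> {}"
    then obtain h where "h \<in> B i" "h \<in> B j" by blast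
    then have "min (real (len (u i))) (real (len (u j))) / 2 \<le> gp (inv (u i)) (inv (u j)) + \<delta>"
      using uc by (intro disj[of _ _ h]) (simp_all add: B_def)
    then show False using sep'[OF that] by linarith
  qed
  moreover have "u i \<otimes> h \<in> A i" if "h \<in> carrier G" "h \<notin> B i" for i h
    using that uc[of i] by (simp add: A_def B_def gp_shift)
  ultimately have norm: "norm (\<Sum>i<n. reg_rep G (u i)) \<le> 2 * sqrt (real n)"
    using uc by (intro norm_sum_reg_rep_le[of n u A B]) (auto simp: disjoint_family_on_def)
  have mem: "(\<Sum>i<n. reg_rep G (u i)) \<in> reduced_cstar G"
    using uc by (intro reduced_cstar_sum reg_rep_reduced)
  have "\<tau> (\<Sum>i<n. reg_rep G (u i)) = (\<Sum>i<n. \<tau> (reg_rep G (u i)))"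
    using uc by (intro functional_sum[OF f] reg_rep_reduced)
  also have "\<dots> = of_nat n * \<tau> (reg_rep G g)"
    using trace_conj[OF \<tau> g(1) u] by simp
  finally have "real n * cmod (\<tau> (reg_rep G g)) \<le> K * (2 * sqrt (real n))"
    using order_trans[OF K(2)[OF mem] mult_left_mono[OF norm K(1)]] by (simp add: norm_mult)
  moreover have "real n = sqrt (real n) * sqrt (real n)" by simp
  ultimately have "sqrt (real n) * (sqrt (real n) * cmod (\<tau> (reg_rep G g))) \<le> sqrt (real n) * (2 * K)"
    by (metis mult.assoc mult.commute)
  moreover have "0 < real n" using n zero_le_power2 by (rule le_less_trans[rotated])
  then have "0 < sqrt (real n)" by simp
  ultimately have "sqrt (real n) * cmod (\<tau> (reg_rep G g)) \<le> 2 * K" by (simp only: mult_le_cancel_left_pos)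
  then have "sqrt (real n) \<le> 2 * K / cmod (\<tau> (reg_rep G g))" using nz by (simp add: pos_le_divide_eq)
  then have "(sqrt (real n))\<^sup>2 \<le> (2 * K / cmod (\<tau> (reg_rep G g)))\<^sup>2" by (intro power_mono) simp_all
  then show False using n by simp
qed

end

lemma word_hyperbolic_length:
  assumes "group G" "word_hyperbolic G"
  obtains len \<delta> where "hyperbolic_length G len \<delta>"
proof -
  obtain S \<delta> where S: "finite S" "S \<subseteq> carrier G" "generate G S = carrier G" "0 < \<delta>" "delta_hyperbolic G S \<delta>"
    using assms(2) by (auto simp: word_hyperbolic_def)
  then interpret cayley G S using assms(1) by (simp add: cayley_def cayley_axioms_def)
  show ?thesis using that hyperbolic_length[OF S(5,4)] .
qed

text \<open>Unique existence is part of the claim because \<open>class_functional\<close> is a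
  definite description, which has its intended meaning only then.\<close>

theorem theorem3p1:
  fixes G :: "('a, 'b) monoid_scheme"
  assumes "group G" and "word_hyperbolic G" and "\<not> elementary G"
  shows "(\<forall>g\<in>carrier G. finite (conj_class G g) \<longrightarrow> (\<exists>!\<phi>. is_class_functional G g \<phi>)) \<and>
    traces G = {(\<lambda>x\<in>reduced_cstar G. \<Sum>g\<in>F. c g * class_functional G g x) | F c.
                  finite F \<and> F \<subseteq> {g \<in> carrier G. finite (conj_class G g)}}"
proof -
  obtain len \<delta> where "hyperbolic_length G len \<delta>" using word_hyperbolic_length[OF assms(1,2)] .
  then interpret hyperbolic_length G len \<delta> .
  have "\<exists>F c. \<tau> = (\<lambda>x\<in>reduced_cstar G. \<Sum>g\<in>F. c g * class_functional G g x) \<and>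
      finite F \<and> F \<subseteq> {g \<in> carrier G. finite (conj_class G g)}" if "\<tau> \<in> traces G" for \<tau>
    using trace_eq_lincomb[OF finite_finite_classes[OF assms(3)] that] trace_vanishes[OF assms(3) that] .
  then show ?thesis using ex1_class_functional lincomb_class_functionals_trace by blast
qed

end
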